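(* On $\mathbf{W}$, we have \begin{gather*} \pi = \frac{\mathcal{T}'+\kappa^{\prime-1}}{\kappa'+\kappa^{\prime-1}}, \qquad \widetilde{\pi} = \frac{\mathcal{T}+\kappa^{-1}}{\kappa+\kappa^{-1}}. \end{gather*}
   Context: Let $\Gamma$ be a dual polar graph with diameter $D\geqslant 3$: its vertex set $X$ is the set of maximal isotropic subspaces of a finite-dimensional vector space over $\mathbb{F}_q$ with a non-degenerate (alternating, quadratic or Hermitian) form of Witt index $D$, two vertices being adjacent iff their intersection has dimension $D-1$; to the type of form is assigned a scalar $e\in\{0,\tfrac12,1,\tfrac32,2\}$. Let $\Gamma_i(x)$ be the set of vertices at distance $i$ from $x$. Fix a vertex $x$ and a maximal clique $C\ni x$; let $C_i$ ($0\leqslant i\leqslant D-1$) be the set of vertices at distance $i$ from $C$, $C_i^-=\Gamma_i(x)\cap C_i$, $C_i^+=\Gamma_{i+1}(x)\cap C_i$. Let $\mathbf{W}\subset\mathbb{C}^X$ be the span of the characteristic vectors $\hat{C}_i^\pm$, with ordered basis $\mathcal{C}=(\hat{C}^-_0,\hat{C}^+_0,\dots,\hat{C}^-_{D-1},\hat{C}^+_{D-1})$. Let $\pi$ be the orthogonal projection (standard Hermitian inner product) from $\mathbf{W}$ onto $M\hat{x}$, the span of the characteristic vectors of the sets $\Gamma_i(x)$, $0\leqslant i\leqslant D$, and $\widetilde{\pi}$ the orthogonal projection from $\mathbf{W}$ onto $M\hat{C}$, the span of the $\hat{C}_i$, $0\leqslant i\leqslant D-1$. Let $\kappa=q^{-e/2}$,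 $\kappa'=\sqrt{-1}q^{-D/2}$, and let $\overline{\mathcal{H}}=\overline{\mathcal{H}}(\kappa,\kappa')$ be the nil-DAHA of type $(C_1^\vee,C_1)$: generated by $\mathcal{T}^{\pm1},\mathcal{U},\mathcal{X}^{\pm1}$ with relations $(\mathcal{T}-\kappa)(\mathcal{T}+\kappa^{-1})=0$, $(\mathcal{T}'-\kappa')(\mathcal{T}'+\kappa'^{-1})=0$, $\mathcal{U}(\mathcal{U}+1)=0$, $\mathcal{U}'^2=0$, where $\mathcal{T}'=\mathcal{X}\mathcal{T}^{-1}$, $\mathcal{U}'=\mathcal{X}^{-1}(\mathcal{U}+1)$. $\mathbf{W}$ is an $\overline{\mathcal{H}}$-module where, in basis $\mathcal{C}$: $\mathcal{T}$ acts by $\operatorname{blockdiag}(t(0),\dots,t(D-1))$ with $t(i)=\begin{pmatrix}q^{-e/2}-q^{e/2}&q^{e/2}\\ q^{-e/2}&0\end{pmatrix}$ on $(\hat C_i^-,\hat C_i^+)$; $\mathcal{U}'$ acts by $\operatorname{blockdiag}(u'(0),\dots,u'(D-1))$ with $u'(i)=\begin{pmatrix}0&0\\ -\sqrt{-1}q^{(D-e)/2-i}&0\end{pmatrix}$ on $(\hat C_i^-,\hat C_i^+)$; $\mathcal{T}'$ acts by $\operatorname{blockdiag}(t'(0),\dots,t'(D))$ and $\mathcal{U}$ by $\operatorname{blockdiag}(u(0),\dots,u(D))$, where $t'(0)=t'(D)=(\sqrt{-1}q^{-D/2})$, $u(0)=(0)$, $u(D)=(-1)$ act on $\hat C_0^-$,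 resp. $\hat C_{D-1}^+$, and for $1\leqslant i\leqslant D-1$ the blocks $t'(i)=\sqrt{-1}\begin{pmatrix}q^{-D/2}(q^D-q^i+1)&q^{D/2}(q^{i-D}-1)\\ q^{-D/2}(1-q^i)&q^{i-D/2}\end{pmatrix}$, $u(i)=\begin{pmatrix}-1&1-q^{D-i}\\0&0\end{pmatrix}$ act on $(\hat C_{i-1}^+,\hat C_i^-)$; and $\mathcal{X}$ acts by the product of the matrices of $\mathcal{T}'$ and $\mathcal{T}$. *)

theory Defs
  imports "HOL-Analysis.Analysis"
begin

definition bilinear_form :: "('f::field^'n \<Rightarrow> 'f^'n \<Rightarrow> 'f) \<Rightarrow> bool" where
  "bilinear_form f \<longleftrightarrow>
     (\<forall>u v w. f (u + v) w = f u w + f v w) \<and> (\<forall>u v w. f u (v + w) = f u v + f u w) \<and>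
     (\<forall>c u w. f (c *s u) w = c * f u w) \<and> (\<forall>c u w. f u (c *s w) = c * f u w)"

definition alternating_form :: "('f::field^'n \<Rightarrow> 'f^'n \<Rightarrow> 'f) \<Rightarrow> bool" where
  "alternating_form f \<longleftrightarrow> bilinear_form f \<and> (\<forall>v. f v v = 0)"

definition nondegenerate :: "('f::field^'n \<Rightarrow> 'f^'n \<Rightarrow> 'f) \<Rightarrow> bool" where
  "nondegenerate f \<longleftrightarrow> (\<forall>v. (\<forall>w. f v w = 0) \<longrightarrow> v = 0)"

definition field_involution :: "('f::field \<Rightarrow> 'f) \<Rightarrow> bool" where
  "field_involution \<sigma> \<longleftrightarrow> (\<forall>a b. \<sigma> (a + b) = \<sigma> a + \<sigma> b) \<and> (\<forall>a b. \<sigma> (a * b) = \<sigma> a * \<sigma> b)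
      \<and> (\<forall>a. \<sigma> (\<sigma> a) = a) \<and> (\<exists>a. \<sigma> a \<noteq> a)"

definition hermitian_form :: "('f::field \<Rightarrow> 'f) \<Rightarrow> ('f^'n \<Rightarrow> 'f^'n \<Rightarrow> 'f) \<Rightarrow> bool" where
  "hermitian_form \<sigma> h \<longleftrightarrow> field_involution \<sigma> \<and>
     (\<forall>u v w. h (u + v) w = h u w + h v w) \<and> (\<forall>c u w. h (c *s u) w = c * h u w) \<and>
     (\<forall>u w. h w u = \<sigma> (h u w))"

definition polar_form :: "('f::field^'n \<Rightarrow> 'f) \<Rightarrow> 'f^'n \<Rightarrow> 'f^'n \<Rightarrow> 'f" where
  "polar_form Q u w = Q (u + w) - Q u - Q w"

definition quadratic_form :: "('f::field^'n \<Rightarrow> 'f) \<Rightarrow> bool" where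
  "quadratic_form Q \<longleftrightarrow> (\<forall>c v. Q (c *s v) = c^2 * Q v) \<and> bilinear_form (polar_form Q)"

definition nondegenerate_quadratic :: "('f::field^'n \<Rightarrow> 'f) \<Rightarrow> bool" where
  "nondegenerate_quadratic Q \<longleftrightarrow> (\<forall>v. Q v = 0 \<and> (\<forall>w. polar_form Q v w = 0) \<longrightarrow> v = 0)"

text \<open>polar_space TI D e: TI is the set of totally isotropic (totally singular, in the
  quadratic case) subspaces of a non-degenerate alternating, Hermitian or quadratic form on
  'f^'n, and e is the scalar assigned to the type of the form (with Witt index D):
  symplectic e = 1; Hermitian e = 1/2 (dim 2D), 3/2 (dim 2D+1);
  quadratic e = 0 (dim 2D), 1 (dim 2D+1), 2 (dim 2D+2).\<close>
definition polar_space :: "('f::{field,finite}^'n) set set \<Rightarrow> nat \<Rightarrow> real \<Rightarrow> bool" where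
  "polar_space TI D e \<longleftrightarrow>
     ((\<exists>f. alternating_form f \<and> nondegenerate f \<and>
           TI = {U. vec.subspace U \<and> (\<forall>u\<in>U. \<forall>w\<in>U. f u w = 0)} \<and> e = 1)
    \<or> (\<exists>\<sigma> h. hermitian_form \<sigma> h \<and> nondegenerate h \<and>
           TI = {U. vec.subspace U \<and> (\<forall>u\<in>U. \<forall>w\<in>U. h u w = 0)} \<and>
           e = real CARD('n) - 2 * real D + 1/2)
    \<or> (\<exists>Q. quadratic_form Q \<and> nondegenerate_quadratic Q \<and>
           TI = {U. vec.subspace U \<and> (\<forall>u\<in>U. Q u = 0)} \<and>
           e = real CARD('n) - 2 * real D))
    \<and> D = Max (vec.dim ` TI)"

definition dp_vertices :: "('f::{field,finite}^'n) set set \<Rightarrow> ('f^'n) set set" where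
  "dp_vertices TI = {U \<in> TI. \<forall>U' \<in> TI. U \<subseteq> U' \<longrightarrow> U' = U}"

definition dp_adj :: "('f::{field,finite}^'n) set set \<Rightarrow> nat \<Rightarrow> ('f^'n) set \<Rightarrow> ('f^'n) set \<Rightarrow> bool" where
  "dp_adj TI D U W \<longleftrightarrow> U \<in> dp_vertices TI \<and> W \<in> dp_vertices TI \<and> vec.dim (U \<inter> W) = D - 1"

definition gdist :: "('a \<Rightarrow> 'a \<Rightarrow> bool) \<Rightarrow> 'a \<Rightarrow> 'a \<Rightarrow> nat" where
  "gdist R u v = (LEAST k. (R ^^ k) u v)"

definition is_clique :: "('a \<Rightarrow> 'a \<Rightarrow> bool) \<Rightarrow> 'a set \<Rightarrow> 'a set \<Rightarrow> bool" where
  "is_clique R X C \<longleftrightarrow> C \<subseteq> X \<and> (\<forall>u\<in>C. \<forall>v\<in>C. u \<noteq> v \<longrightarrow> R u v)"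

definition is_maximal_clique :: "('a \<Rightarrow> 'a \<Rightarrow> bool) \<Rightarrow> 'a set \<Rightarrow> 'a set \<Rightarrow> bool" where
  "is_maximal_clique R X C \<longleftrightarrow> is_clique R X C \<and> (\<forall>C'. is_clique R X C' \<and> C \<subseteq> C' \<longrightarrow> C' = C)"

definition set_dist :: "('a \<Rightarrow> 'a \<Rightarrow> bool) \<Rightarrow> 'a set \<Rightarrow> 'a \<Rightarrow> nat" where
  "set_dist R C v = (LEAST k. \<exists>c\<in>C. gdist R c v = k)"

definition Gam :: "('a \<Rightarrow> 'a \<Rightarrow> bool) \<Rightarrow> 'a set \<Rightarrow> 'a \<Rightarrow> nat \<Rightarrow> 'a set" where
  "Gam R X x i = {v \<in> X. gdist R x v = i}"

definition Cminus :: "('a \<Rightarrow> 'a \<Rightarrow> bool) \<Rightarrow> 'a set \<Rightarrow> 'a \<Rightarrow> 'a set \<Rightarrow> nat \<Rightarrow> 'a set" where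
  "Cminus R X x C i = {v \<in> X. set_dist R C v = i \<and> gdist R x v = i}"

definition Cplus :: "('a \<Rightarrow> 'a \<Rightarrow> bool) \<Rightarrow> 'a set \<Rightarrow> 'a \<Rightarrow> 'a set \<Rightarrow> nat \<Rightarrow> 'a set" where
  "Cplus R X x C i = {v \<in> X. set_dist R C v = i \<and> gdist R x v = i + 1}"

text \<open>Elements of C^X are functions 'a => complex (only values on X matter).\<close>
definition charvec :: "'a set \<Rightarrow> 'a \<Rightarrow> complex" where
  "charvec S = (\<lambda>v. if v \<in> S then 1 else 0)"

definition herm_ip :: "'a set \<Rightarrow> ('a \<Rightarrow> complex) \<Rightarrow> ('a \<Rightarrow> complex) \<Rightarrow> complex" where
  "herm_ip X f g = (\<Sum>v\<in>X. f v * cnj (g v))"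

definition fspan :: "('a \<Rightarrow> complex) set \<Rightarrow> ('a \<Rightarrow> complex) set" where
  "fspan G = {(\<lambda>v. \<Sum>g\<in>G. c g * g v) | c. True}"

definition orth_proj :: "'a set \<Rightarrow> ('a \<Rightarrow> complex) set \<Rightarrow> ('a \<Rightarrow> complex) \<Rightarrow> ('a \<Rightarrow> complex)" where
  "orth_proj X G w = (THE p. p \<in> fspan G \<and> (\<forall>g\<in>G. herm_ip X (\<lambda>v. w v - p v) g = 0))"

text \<open>Position 2i is C_i^-, position 2i+1 is C_i^+. A matrix M (r,s) acts on coordinate
  columns: the image of the s-th basis vector is the sum over r of M r s times the r-th.\<close>
definition basis_vec :: "('a \<Rightarrow> 'a \<Rightarrow> bool) \<Rightarrow> 'a set \<Rightarrow> 'a \<Rightarrow> 'a set \<Rightarrow> nat \<Rightarrow> 'a \<Rightarrow> complex" where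
  "basis_vec R X x C j =
     (if even j then charvec (Cminus R X x C (j div 2)) else charvec (Cplus R X x C (j div 2)))"

definition Tmat :: "real \<Rightarrow> real \<Rightarrow> nat \<Rightarrow> nat \<Rightarrow> complex" where
  "Tmat q e r s =
     (if r div 2 = s div 2 then
        (if even r \<and> even s then complex_of_real (q powr (-e/2) - q powr (e/2))
         else if even r then complex_of_real (q powr (e/2))
         else if even s then complex_of_real (q powr (-e/2))
         else 0)
      else 0)"

text \<open>T' = blockdiag(t'(0),...,t'(D)); t'(0) on position 0, t'(D) on position 2D-1,
  t'(i) (1 <= i <= D-1) on positions (2i-1, 2i) = (C_(i-1)^+, C_i^-).
  The block of position p is (p+1) div 2.\<close>
definition T'mat :: "real \<Rightarrow> nat \<Rightarrow> nat \<Rightarrow> nat \<Rightarrow> complex" where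
  "T'mat q D r s =
     (let i = (r + 1) div 2 in
      if i \<noteq> (s + 1) div 2 then 0
      else if i = 0 \<or> i = D then (if r = s then \<i> * complex_of_real (q powr (- real D / 2)) else 0)
      else if odd r \<and> odd s then
        \<i> * complex_of_real (q powr (- real D / 2) * (q ^ D - q ^ i + 1))
      else if odd r then
        \<i> * complex_of_real (q powr (real D / 2) * (q powr (real i - real D) - 1))
      else if odd s then
        \<i> * complex_of_real (q powr (- real D / 2) * (1 - q ^ i))
      else \<i> * complex_of_real (q powr (real i - real D / 2)))"

end

theory Submission
  imports Defs
begin

text \<open>The three types of forms share one description: a form linear in its first argument with a
  symmetric orthogonality relation, and a class of isotropic vectors such that on every line
  \<open>p + a z\<close> with \<open>z\<close> isotropic and not orthogonal to \<open>p\<close> the number \<open>s\<close> of isotropic points is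
  constant. A maximal clique through \<open>x\<close> consists of the vertices containing a hyperplane \<open>E\<close>
  of \<open>x\<close>; since distances are codimensions of intersections, \<open>C\<^sub>i\<^sup>-\<close> and \<open>C\<^sub>i\<^sup>+\<close> are described by the
  dimension of \<open>x \<inter> v\<close> and by whether \<open>x \<inter> v \<subseteq> E\<close>. The number of vertices \<open>v\<close> with \<open>x \<inter> v = W\<close>
  depends only on the dimension of \<open>W\<close>. Counting the subspaces \<open>W\<close> of \<open>x\<close> inside and outside \<open>E\<close>
  gives \<open>(q\<^sup>D - q\<^sup>i) card C\<^sub>i\<^sub>-\<^sub>1\<^sup>+ = (q\<^sup>i - 1) card C\<^sub>i\<^sup>-\<close>; comparing the nearest points in \<open>C\<close> of the
  vertices at distance \<open>i\<close> from \<open>C\<close> gives \<open>card C\<^sub>i\<^sup>+ = q\<^sup>e card C\<^sub>i\<^sup>-\<close>. The orthogonal projections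
  average over the blocks, and these ratios are exactly the entries of the two matrices.\<close>

section \<open>Counting subspaces over a finite field\<close>

lemma vec_in_span_insert:
  fixes U :: "('f::field^'n) set"
  assumes "vec.subspace U"
  shows "y \<in> vec.span (insert p U) \<longleftrightarrow> (\<exists>u\<in>U. \<exists>a. y = u + a *s p)"
proof -
  have "y \<in> vec.span (insert p U) \<longleftrightarrow> (\<exists>k. y - k *s p \<in> U)"
    using assms by (simp add: vec.span_breakdown_eq vec.span_eq_iff[THEN iffD2])
  also have "\<dots> \<longleftrightarrow> (\<exists>u\<in>U. \<exists>a. y = u + a *s p)"
  proof
    assume "\<exists>u\<in>U. \<exists>a. y = u + a *s p"
    then show "\<exists>k. y - k *s p \<in> U" by (metis add_diff_cancel_right')
  next
    assume "\<exists>k. y - k *s p \<in> U"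
    then show "\<exists>u\<in>U. \<exists>a. y = u + a *s p" by (metis diff_add_cancel)
  qed
  finally show ?thesis .
qed

lemma dim_span_insert:
  fixes U :: "('f::field^'n) set"
  assumes "vec.subspace U" "p \<notin> U"
  shows "vec.dim (vec.span (insert p U)) = vec.dim U + 1"
  using assms by (simp add: vec.dim_insert vec.span_eq_iff[THEN iffD2])

lemma card_subspace:
  fixes U :: "('f::{field,finite}^'n) set"
  assumes "vec.subspace U"
  shows "card U = CARD('f) ^ vec.dim U"
proof -
  have *: "finite S \<Longrightarrow> vec.independent S \<Longrightarrow> card (vec.span S) = CARD('f) ^ card S"
    for S :: "('f^'n) set"
  proof (induction S rule: finite_induct)
    case empty
    then show ?case by simp
  next
    case (insert p S)
    then have ind: "vec.independent S" and p: "p \<notin> vec.span S"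
      by (auto simp: vec.independent_insert)
    have "bij_betw (\<lambda>(u, a). u + a *s p) (vec.span S \<times> UNIV) (vec.span (insert p S))"
    proof (rule bij_betwI')
      fix y z assume yz: "y \<in> vec.span S \<times> (UNIV::'f set)" "z \<in> vec.span S \<times> (UNIV::'f set)"
      obtain u a v b where eq: "y = (u, a)" "z = (v, b)" by (cases y, cases z)
      show "((case y of (u, a) \<Rightarrow> u + a *s p) = (case z of (u, a) \<Rightarrow> u + a *s p)) = (y = z)"
      proof
        assume "(case y of (u, a) \<Rightarrow> u + a *s p) = (case z of (u, a) \<Rightarrow> u + a *s p)"
        then have h: "u + a *s p = v + b *s p" using eq by simp
        then have h2: "(b - a) *s p = u - v"
          by (simp add: vec.scale_left_diff_distrib algebra_simps)
        have "u - v \<in> vec.span S" using yz eq by (auto intro: vec.span_diff)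
        then have "(b - a) *s p \<in> vec.span S" by (simp only: h2)
        have "b - a = 0"
        proof (rule ccontr)
          assume "b - a \<noteq> 0"
          then have "inverse (b - a) *s ((b - a) *s p) = p"
            by (simp only: vec.scale_scale left_inverse[OF \<open>b - a \<noteq> 0\<close>] vec.scale_one)
          then show False using p vec.span_scale[OF \<open>(b - a) *s p \<in> vec.span S\<close>] by metis
        qed
        then show "y = z" using h eq by simp
      qed simp
    next
      fix y :: "('f^'n) \<times> 'f" assume "y \<in> vec.span S \<times> UNIV"
      then show "(case y of (u, a) \<Rightarrow> u + a *s p) \<in> vec.span (insert p S)"
        by (auto simp: vec.span_breakdown_eq intro: exI[of _ "snd y"])
    next
      fix y assume "y \<in> vec.span (insert p S)"
      then obtain k where "y - k *s p \<in> vec.span S" by (auto simp: vec.span_breakdown_eq)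
      then show "\<exists>z\<in>vec.span S \<times> UNIV. y = (case z of (u, a) \<Rightarrow> u + a *s p)"
        by (intro bexI[of _ "(y - k *s p, k)"]) auto
    qed
    from bij_betw_same_card[OF this]
    have "card (vec.span (insert p S)) = card (vec.span S) * CARD('f)"
      by (simp add: card_cartesian_product)
    then show ?case using insert ind by simp
  qed
  obtain S where S: "S \<subseteq> U" "vec.independent S" "U \<subseteq> vec.span S" "card S = vec.dim U"
    using vec.basis_exists[of U] by blast
  have "vec.span S = U" using vec.span_subspace[OF S(1,3) assms] .
  with *[OF finite S(2)] S(4) show ?thesis by simp
qed

lemma card_field_ge2: "CARD('f::{field,finite}) \<ge> 2"
proof -
  have "card {0, 1 :: 'f} \<le> CARD('f)" by (rule card_mono) auto
  then show ?thesis by simp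
qed

text \<open>Since \<open>\<phi> w\<close> is nonzero, U splits as the kernel plus the line through
  w, and \<open>(u, a) \<mapsto> u + a *s w\<close> counts U as kernel times field.\<close>

lemma card_kernel:
  fixes U :: "('f::{field,finite}^'n) set" and \<phi> :: "'f^'n \<Rightarrow> 'f"
  assumes U: "vec.subspace U"
    and add: "\<And>u v. \<phi> (u + v) = \<phi> u + \<phi> v" and scale: "\<And>c u. \<phi> (c *s u) = c * \<phi> u"
    and nz: "w \<in> U" "\<phi> w \<noteq> 0"
  shows "card {u\<in>U. \<phi> u = 0} * CARD('f) = card U"
proof -
  have diff: "\<phi> (u - v) = \<phi> u - \<phi> v" for u v
    using add[of "u - v" v] by (simp add: algebra_simps)
  have "bij_betw (\<lambda>(u, a). u + a *s w) ({u\<in>U. \<phi> u = 0} \<times> UNIV) U"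
  proof (rule bij_betwI')
    fix y z assume yz: "y \<in> {u\<in>U. \<phi> u = 0} \<times> (UNIV::'f set)" "z \<in> {u\<in>U. \<phi> u = 0} \<times> (UNIV::'f set)"
    obtain u a v b where eq: "y = (u, a)" "z = (v, b)" by (cases y, cases z)
    show "((case y of (u, a) \<Rightarrow> u + a *s w) = (case z of (u, a) \<Rightarrow> u + a *s w)) = (y = z)"
    proof
      assume "(case y of (u, a) \<Rightarrow> u + a *s w) = (case z of (u, a) \<Rightarrow> u + a *s w)"
      then have h: "u + a *s w = v + b *s w" using eq by simp
      then have "\<phi> (u + a *s w) = \<phi> (v + b *s w)" by simp
      then have "a = b" using nz yz eq by (simp add: add scale)
      then show "y = z" using h eq by simp
    qed simp
  next
    fix y :: "('f^'n) \<times> 'f" assume "y \<in> {u\<in>U. \<phi> u = 0} \<times> UNIV"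
    then show "(case y of (u, a) \<Rightarrow> u + a *s w) \<in> U"
      using nz U by (auto intro!: vec.subspace_add vec.subspace_scale)
  next
    fix y assume "y \<in> U"
    then show "\<exists>z\<in>{u\<in>U. \<phi> u = 0} \<times> UNIV. y = (case z of (u, a) \<Rightarrow> u + a *s w)"
      using nz U
      by (intro bexI[of _ "(y - (\<phi> y / \<phi> w) *s w, \<phi> y / \<phi> w)"])
        (auto simp: diff scale intro!: vec.subspace_diff vec.subspace_scale)
  qed
  from bij_betw_same_card[OF this] show ?thesis by (simp add: card_cartesian_product)
qed

lemma double_count:
  assumes "finite A" "finite B"
  shows "(\<Sum>a\<in>A. card {b\<in>B. P a b}) = (\<Sum>b\<in>B. card {a\<in>A. P a b})"
proof -
  have "(\<Sum>a\<in>A. card {b\<in>B. P a b}) = (\<Sum>a\<in>A. \<Sum>b\<in>B. if P a b then 1 else 0)"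
    using assms by (simp add: sum.inter_filter[symmetric])
  also have "\<dots> = (\<Sum>b\<in>B. \<Sum>a\<in>A. if P a b then 1 else 0)" by (rule sum.swap)
  also have "\<dots> = (\<Sum>b\<in>B. card {a\<in>A. P a b})"
    using assms by (simp add: sum.inter_filter[symmetric])
  finally show ?thesis .
qed

text \<open>Count the pairs (W, w) with W in F above Z and w in W but not in Z: each W contributes
  \<open>q ^ k - q ^ z\<close> vectors. This trades a count above Z for counts above the larger
  spaces Z + <w>, which drives the two downward inductions below.\<close>

lemma double_count_superspaces:
  fixes U Z :: "('f::{field,finite}^'n) set"
  assumes F: "\<And>W. W \<in> F \<Longrightarrow> vec.subspace W \<and> W \<subseteq> U \<and> vec.dim W = k"
    and Z: "vec.subspace Z" "vec.dim Z = z"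
  shows "real (card {W\<in>F. Z \<subseteq> W}) * (real CARD('f) ^ k - real CARD('f) ^ z)
       = (\<Sum>w\<in>U - Z. real (card {W\<in>F. vec.span (insert w Z) \<subseteq> W}))"
proof -
  have "(\<Sum>W\<in>{W\<in>F. Z \<subseteq> W}. card {w\<in>U - Z. w \<in> W}) = (\<Sum>w\<in>U - Z. card {W\<in>{W\<in>F. Z \<subseteq> W}. w \<in> W})"
    by (rule double_count) auto
  then have dc: "(\<Sum>W\<in>{W\<in>F. Z \<subseteq> W}. real (card {w\<in>U - Z. w \<in> W}))
      = (\<Sum>w\<in>U - Z. real (card {W\<in>{W\<in>F. Z \<subseteq> W}. w \<in> W}))"
    by (simp only: of_nat_sum[symmetric])
  have fibre: "real (card {w\<in>U - Z. w \<in> W}) = real CARD('f) ^ k - real CARD('f) ^ z"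
    if "W \<in> {W\<in>F. Z \<subseteq> W}" for W
  proof -
    have W: "W \<in> F" "Z \<subseteq> W" using that by auto
    have "{w\<in>U - Z. w \<in> W} = W - Z" using F[OF W(1)] by auto
    moreover have "real (card (W - Z)) = real (card W) - real (card Z)"
      using W by (simp add: card_Diff_subset card_mono of_nat_diff)
    ultimately show ?thesis using F[OF W(1)] Z by (simp add: card_subspace)
  qed
  have "{W\<in>{W\<in>F. Z \<subseteq> W}. w \<in> W} = {W\<in>F. vec.span (insert w Z) \<subseteq> W}" for w
  proof -
    have "vec.span (insert w Z) \<subseteq> W \<longleftrightarrow> Z \<subseteq> W \<and> w \<in> W" if "W \<in> F" for W
      using F[OF that] by (metis insert_subset order_trans vec.span_minimal vec.span_superset)
    then show ?thesis by auto
  qed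
  with dc fibre show ?thesis by simp
qed

text \<open>A Gaussian binomial coefficient, kept as an unreduced product. Downward induction on dim
  Z, from Z itself at dimension k: every w in U outside Z gives the same number of subspaces above Z
  + <w>.\<close>

lemma card_subspaces_between:
  fixes U Z :: "('f::{field,finite}^'n) set"
  assumes U: "vec.subspace U" "vec.dim U = n"
    and Z: "vec.subspace Z" "Z \<subseteq> U" "vec.dim Z = z" and k: "z \<le> k" "k \<le> n"
  shows "real (card {W. vec.subspace W \<and> W \<subseteq> U \<and> vec.dim W = k \<and> Z \<subseteq> W})
       = (\<Prod>j=z..<k. (real CARD('f) ^ n - real CARD('f) ^ j) / (real CARD('f) ^ k - real CARD('f) ^ j))"
  using k(1) Z
proof (induction z arbitrary: Z rule: inc_induct)
  case base
  then have "{W. vec.subspace W \<and> W \<subseteq> U \<and> vec.dim W = k \<and> Z \<subseteq> W} = {Z}"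
    by (auto dest: vec.subspace_dim_equal[of Z])
  then show ?case by simp
next
  case (step z)
  let ?q = "real CARD('f)"
  define F where "F = {W. vec.subspace W \<and> W \<subseteq> U \<and> vec.dim W = k}"
  have q: "?q ^ k - ?q ^ z \<noteq> 0"
    using step.hyps card_field_ge2[where 'f='f] by simp
  have "real (card {W\<in>F. Z \<subseteq> W}) * (?q ^ k - ?q ^ z)
      = (\<Sum>w\<in>U - Z. real (card {W\<in>F. vec.span (insert w Z) \<subseteq> W}))"
    by (rule double_count_superspaces) (use step F_def in auto)
  also have "\<dots> = (\<Sum>w\<in>U - Z. \<Prod>j=Suc z..<k. (?q ^ n - ?q ^ j) / (?q ^ k - ?q ^ j))"
  proof (rule sum.cong[OF refl])
    fix w assume w: "w \<in> U - Z"
    have "vec.span (insert w Z) \<subseteq> U" using w U step.prems by (simp add: vec.span_minimal)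
    moreover have "vec.dim (vec.span (insert w Z)) = Suc z"
      using w step.prems dim_span_insert[of Z w] by simp
    ultimately show "real (card {W\<in>F. vec.span (insert w Z) \<subseteq> W})
        = (\<Prod>j=Suc z..<k. (?q ^ n - ?q ^ j) / (?q ^ k - ?q ^ j))"
      using step.IH[of "vec.span (insert w Z)"]
      by (simp add: F_def conj_assoc del: insert_subset vec.span_insert_0)
  qed
  also have "\<dots> = (?q ^ n - ?q ^ z) * (\<Prod>j=Suc z..<k. (?q ^ n - ?q ^ j) / (?q ^ k - ?q ^ j))"
  proof -
    have "real (card (U - Z)) = real (card U) - real (card Z)"
      using step.prems by (simp add: card_Diff_subset card_mono of_nat_diff)
    then show ?thesis using U step.prems by (simp add: card_subspace)
  qed
  finally have eq: "real (card {W\<in>F. Z \<subseteq> W}) * (?q ^ k - ?q ^ z)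
      = (?q ^ n - ?q ^ z) * (\<Prod>j=Suc z..<k. (?q ^ n - ?q ^ j) / (?q ^ k - ?q ^ j))" .
  have "real (card {W\<in>F. Z \<subseteq> W})
      = (?q ^ n - ?q ^ z) / (?q ^ k - ?q ^ z) * (\<Prod>j=Suc z..<k. (?q ^ n - ?q ^ j) / (?q ^ k - ?q ^ j))"
    using q by (metis (no_types, lifting) eq nonzero_mult_div_cancel_right times_divide_eq_left)
  moreover have "{W\<in>F. Z \<subseteq> W} = {W. vec.subspace W \<and> W \<subseteq> U \<and> vec.dim W = k \<and> Z \<subseteq> W}"
    by (auto simp: F_def)
  ultimately show ?case
    using step.hyps by (simp add: prod.atLeast_Suc_lessThan)
qed

text \<open>The quotient of the Gaussian binomials for n - 1 and n over k, cross-multiplied. It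
  later decides how the vertices at a fixed distance from x split according to whether their
  intersection with x lies in E.\<close>

lemma card_subspaces_hyperplane_ratio:
  fixes U E :: "('f::{field,finite}^'n) set"
  assumes U: "vec.subspace U" "vec.dim U = n" and E: "vec.subspace E" "vec.dim E = n - 1"
    and k: "k < n"
  shows "real (card {W. vec.subspace W \<and> W \<subseteq> E \<and> vec.dim W = k}) * (real CARD('f) ^ n - 1)
       = real (card {W. vec.subspace W \<and> W \<subseteq> U \<and> vec.dim W = k}) * (real CARD('f) ^ (n - k) - 1)"
proof -
  define q where "q = real CARD('f)"
  have q: "q \<ge> 2" using card_field_ge2[where 'f='f] by (simp add: q_def)
  have cnt: "real (card {W. vec.subspace W \<and> W \<subseteq> V \<and> vec.dim W = k})
      = (\<Prod>j=0..<k. (q ^ m - q ^ j) / (q ^ k - q ^ j))"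
    if "vec.subspace V" "vec.dim V = m" "k \<le> m" for V :: "('f^'n) set" and m
  proof -
    have "{W. vec.subspace W \<and> W \<subseteq> V \<and> vec.dim W = k}
        = {W. vec.subspace W \<and> W \<subseteq> V \<and> vec.dim W = k \<and> {0} \<subseteq> W}"
      using vec.subspace_0 by blast
    then show ?thesis
      using card_subspaces_between[of V m "{0}" 0 k] that
      by (simp add: q_def vec.subspace_0)
  qed
  \<comment> \<open>The products telescope because
    \<open>q * (q ^ (n - 1) - q ^ j) = q ^ n - q ^ (j + 1)\<close>: the factors agree up to a shift
    of j and powers of q.\<close>
  have tele: "(\<Prod>j=0..<k. q ^ (n - 1) - q ^ j) * (q ^ n - 1)
      = (\<Prod>j=0..<k. q ^ n - q ^ j) * (q ^ (n - k) - 1)"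
    using k
  proof (induction k)
    case 0
    then show ?case by simp
  next
    case (Suc k)
    have "(\<Prod>j=0..<Suc k. q ^ (n - 1) - q ^ j) * (q ^ n - 1)
        = (\<Prod>j=0..<k. q ^ n - q ^ j) * ((q ^ (n - k) - 1) * (q ^ (n - 1) - q ^ k))"
      using Suc by simp
    also have "(q ^ (n - k) - 1) * (q ^ (n - 1) - q ^ k) = (q ^ n - q ^ k) * (q ^ (n - Suc k) - 1)"
    proof -
      obtain m where m: "n = Suc (k + m)" using Suc.prems less_iff_Suc_add by auto
      then have [simp]: "n - k = Suc m" "n - Suc k = m" "n - 1 = k + m" by auto
      show ?thesis by (simp add: m algebra_simps power_add)
    qed
    finally show ?case by simp
  qed
  have "real (card {W. vec.subspace W \<and> W \<subseteq> E \<and> vec.dim W = k}) * (q ^ n - 1)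
      = (\<Prod>j=0..<k. q ^ (n - 1) - q ^ j) * (q ^ n - 1) / (\<Prod>j=0..<k. q ^ k - q ^ j)"
    using cnt[OF E] k by (simp add: prod_dividef)
  also have "\<dots> = (\<Prod>j=0..<k. q ^ n - q ^ j) * (q ^ (n - k) - 1) / (\<Prod>j=0..<k. q ^ k - q ^ j)"
    by (simp only: tele)
  also have "\<dots> = real (card {W. vec.subspace W \<and> W \<subseteq> U \<and> vec.dim W = k}) * (q ^ (n - k) - 1)"
    using cnt[OF U] k by (simp add: prod_dividef)
  finally show ?thesis by (simp only: q_def)
qed

lemma vec_exchange:
  fixes U :: "('f::field^'n) set"
  assumes U: "vec.subspace U" and w: "w \<in> vec.span (insert p U)" "w \<notin> U"
  shows "p \<in> vec.span (insert w U)"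
proof -
  obtain u a where h: "u \<in> U" "w = u + a *s p"
    using w(1) by (auto simp: vec_in_span_insert[OF U])
  have a: "a \<noteq> 0" using h w(2) by auto
  have "inverse a *s (a *s p) = p"
    by (simp only: vec.scale_scale left_inverse[OF a] vec.scale_one)
  moreover have "a *s p = w - u" using h by simp
  ultimately have "p = (- inverse a) *s u + inverse a *s w"
    by (metis add.commute diff_conv_add_uminus vec.scale_minus_left vec.scale_right_diff_distrib)
  moreover have "(- inverse a) *s u \<in> U" using h U by (metis vec.subspace_scale)
  ultimately show ?thesis using vec_in_span_insert[OF U] by blast
qed

text \<open>The same downward induction on dim Z, from hyperplanes downwards. Vectors w in Z + <p>
  contribute nothing, because by exchange p would lie in Z + <w> and hence in H; all other w
  contribute equally.\<close>

lemma card_complements_above: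
  fixes U Z :: "('f::{field,finite}^'n) set"
  assumes U: "vec.subspace U" "vec.dim U = n" "p \<in> U"
    and Z: "vec.subspace Z" "Z \<subseteq> U" "vec.dim Z = z" "p \<notin> Z"
  shows "card {H. vec.subspace H \<and> H \<subseteq> U \<and> vec.dim H = n - 1 \<and> p \<notin> H \<and> Z \<subseteq> H}
       = CARD('f) ^ (n - 1 - z)"
proof -
  have "z < n"
  proof -
    have "vec.span (insert p Z) \<subseteq> U" using assms by (simp add: vec.span_minimal)
    then have "vec.dim (vec.span (insert p Z)) \<le> n" using vec.dim_subset U(2) by blast
    then show ?thesis using dim_span_insert[OF Z(1,4)] Z(3) by simp
  qed
  then have "z \<le> n - 1" by simp
  then show ?thesis using Z
  proof (induction z arbitrary: Z rule: inc_induct)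
    case base
    then have "{H. vec.subspace H \<and> H \<subseteq> U \<and> vec.dim H = n - 1 \<and> p \<notin> H \<and> Z \<subseteq> H} = {Z}"
      by (auto dest: vec.subspace_dim_equal[of Z])
    then show ?case by simp
  next
    case (step z)
    define q where "q = real CARD('f)"
    define F where "F = {H. vec.subspace H \<and> H \<subseteq> U \<and> vec.dim H = n - 1 \<and> p \<notin> H}"
    have q: "q \<ge> 2" using card_field_ge2[where 'f='f] by (simp add: q_def)
    let ?Zp = "vec.span (insert p Z)"
    have Zp: "?Zp \<subseteq> U" using step.prems U by (simp add: vec.span_minimal)
    have dZp: "vec.dim ?Zp = z + 1" using dim_span_insert[of Z p] step.prems by simp
    have fibre: "real (card {H\<in>F. vec.span (insert w Z) \<subseteq> H}) = (if w \<in> ?Zp then 0 else q ^ (n - 1 - Suc z))"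
      if w: "w \<in> U - Z" for w
    proof (cases "w \<in> ?Zp")
      case True
      then have "p \<in> vec.span (insert w Z)" using vec_exchange[of Z w p] step.prems w by blast
      then have "{H\<in>F. vec.span (insert w Z) \<subseteq> H} = {}" by (auto simp: F_def)
      then show ?thesis using True by simp
    next
      case False
      have "p \<notin> vec.span (insert w Z)"
        using vec_exchange[of Z p w] step.prems False by blast
      moreover have "vec.span (insert w Z) \<subseteq> U" using w U step.prems by (simp add: vec.span_minimal)
      moreover have "vec.dim (vec.span (insert w Z)) = Suc z"
        using w step.prems dim_span_insert[of Z w] by simp
      ultimately have "card {H\<in>F. vec.span (insert w Z) \<subseteq> H} = CARD('f) ^ (n - 1 - Suc z)"
        using step.IH[of "vec.span (insert w Z)"] by (simp add: F_def conj_assoc)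
      then show ?thesis using False by (simp add: q_def)
    qed
    have "real (card {H\<in>F. Z \<subseteq> H}) * (q ^ (n - 1) - q ^ z)
        = (\<Sum>w\<in>U - Z. real (card {H\<in>F. vec.span (insert w Z) \<subseteq> H}))"
      unfolding q_def by (rule double_count_superspaces) (use step F_def in auto)
    also have "\<dots> = (\<Sum>w\<in>U - Z. if w \<in> ?Zp then 0 else q ^ (n - 1 - Suc z))"
      by (rule sum.cong[OF refl fibre])
    also have "\<dots> = (\<Sum>w\<in>U - ?Zp. q ^ (n - 1 - Suc z))"
      by (rule sum.mono_neutral_cong_right) (auto simp: vec.span_base)
    also have "\<dots> = (q ^ n - q ^ (z + 1)) * q ^ (n - 1 - Suc z)"
    proof -
      have "real (card (U - ?Zp)) = real (card U) - real (card ?Zp)"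
        using Zp by (simp add: card_Diff_subset card_mono of_nat_diff)
      then show ?thesis using U dZp by (simp add: card_subspace q_def)
    qed
    also have "\<dots> = q ^ (n - 1 - z) * (q ^ (n - 1) - q ^ z)"
    proof -
      obtain m where m: "n = Suc (Suc (z + m))"
        using step.hyps by (metis Suc_diff_1 add_Suc less_iff_Suc_add less_nat_zero_code diff_is_0_eq
            not_less_eq_eq zero_less_diff bot_nat_0.not_eq_extremum)
      then have [simp]: "n - 1 = Suc (z + m)" by simp
      show ?thesis by (simp add: m algebra_simps)
    qed
    finally have "real (card {H\<in>F. Z \<subseteq> H}) = q ^ (n - 1 - z)"
      using q step.hyps by simp
    then show ?case by (simp add: F_def q_def conj_assoc flip: of_nat_power)
  qed
qed

section \<open>Polar spaces\<close>

text \<open>\<open>M + 1\<close> is the size of a maximal clique; for a form of type \<open>e\<close> it turns out that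
  \<open>M = q powr e\<close>. The assumption \<open>M_eq\<close> only fixes the value of \<open>M\<close>.\<close>

locale polar =
  fixes B :: "'f::{field,finite}^'n \<Rightarrow> 'f^'n \<Rightarrow> 'f" and iso :: "'f^'n \<Rightarrow> bool"
    and s :: nat and TI :: "('f^'n) set set" and D :: nat and q M :: real
  assumes B_add: "B (u + v) w = B u w + B v w"
    and B_scale: "B (c *s u) w = c * B u w"
    and B_sym: "B u w = 0 \<longleftrightarrow> B w u = 0"
    and iso_0: "iso 0"
    and iso_scale: "iso u \<Longrightarrow> iso (c *s u)"
    and iso_add: "iso u \<Longrightarrow> iso v \<Longrightarrow> B u v = 0 \<Longrightarrow> iso (u + v)"
    and iso_self: "iso u \<Longrightarrow> B u u = 0"
    and nondeg: "iso u \<Longrightarrow> (\<And>w. B u w = 0) \<Longrightarrow> u = 0"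
    and iso_count: "iso z \<Longrightarrow> B p z \<noteq> 0 \<Longrightarrow> card {a. iso (p + a *s z)} = s"
    and s_pos: "s > 0"
    and TI_eq: "TI = {U. vec.subspace U \<and> (\<forall>u\<in>U. iso u) \<and> (\<forall>u\<in>U. \<forall>w\<in>U. B u w = 0)}"
    and D_eq: "D = Max (vec.dim ` TI)"
    and D_pos: "D \<ge> 1"
    and q_eq: "q = real CARD('f)"
    and M_eq: "M * q ^ (2 * D) = real s * q ^ CARD('n)"
begin

abbreviation X where "X \<equiv> dp_vertices TI"

text \<open>The varying vector stands in the first argument, where B is linear, so this is a
  subspace also for Hermitian forms.\<close>

definition perp :: "('f^'n) set \<Rightarrow> ('f^'n) set" where
  "perp U = {v. \<forall>u\<in>U. B v u = 0}"

lemma q_ge2: "q \<ge> 2"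
  using card_field_ge2[where 'f='f] by (simp add: q_eq)

lemma M_pos: "M > 0"
proof -
  have "M * q ^ (2 * D) > 0" using s_pos q_ge2 by (simp add: M_eq)
  then show ?thesis using q_ge2 by (simp add: zero_less_mult_iff)
qed

lemma B_0: "B 0 w = 0"
  using B_scale[of 0 0 w] by simp

section \<open>Orthogonal subspaces and duality of dimensions\<close>

lemma subspace_perp: "vec.subspace (perp U)"
  by (auto simp: vec.subspace_def perp_def B_0 B_add B_scale)

lemma perp_antimono: "U \<subseteq> V \<Longrightarrow> perp V \<subseteq> perp U"
  by (auto simp: perp_def)

lemma perp_sym: "U \<subseteq> perp V \<longleftrightarrow> V \<subseteq> perp U"
  using B_sym by (auto simp: perp_def)

lemma perp_span: "perp (vec.span U) = perp U"
proof
  show "perp (vec.span U) \<subseteq> perp U" by (intro perp_antimono vec.span_superset)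
  have "vec.span U \<subseteq> perp (perp U)"
    by (intro vec.span_minimal subspace_perp) (rule perp_sym[THEN iffD2, OF order_refl])
  then show "perp U \<subseteq> perp (vec.span U)" by (rule perp_sym[THEN iffD1])
qed

text \<open>For fixed v the map \<open>u \<mapsto> B u v\<close> is linear on U: it vanishes if v
  lies in \<open>perp U\<close>, and otherwise its kernel is a fraction 1/q of U. The factor
  \<open>CARD('f)\<close> on the left avoids division.\<close>

lemma card_perp_pairs:
  assumes "vec.subspace U"
  shows "(\<Sum>v\<in>V. card {u\<in>U. B u v = 0}) * CARD('f)
    = card U * (card V + (CARD('f) - 1) * card (V \<inter> perp U))"
proof -
  have fibre: "card {u\<in>U. B u v = 0} * CARD('f) = card U * (1 + (if v \<in> perp U then CARD('f) - 1 else 0))" for v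
  proof (cases "v \<in> perp U")
    case True
    then have "{u\<in>U. B u v = 0} = U" using B_sym by (auto simp: perp_def)
    then show ?thesis using True by simp
  next
    case False
    then obtain w where "w \<in> U" "B w v \<noteq> 0" using B_sym by (auto simp: perp_def)
    then show ?thesis
      using False card_kernel[OF assms, of "\<lambda>u. B u v" w] B_add B_scale by simp
  qed
  have "(\<Sum>v\<in>V. card {u\<in>U. B u v = 0}) * CARD('f)
      = card U * (\<Sum>v\<in>V. 1 + (if v \<in> perp U then CARD('f) - 1 else 0))"
    by (simp only: sum_distrib_right sum_distrib_left fibre)
  also have "(\<Sum>v\<in>V. 1 + (if v \<in> perp U then CARD('f) - 1 else 0))
      = card V + (CARD('f) - 1) * card (V \<inter> perp U)"
    by (simp only: sum.distrib sum.If_cases[OF finite]) simp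
  finally show ?thesis .
qed

text \<open>Both sides are read off from the number of orthogonal pairs in \<open>U \<times> V\<close>, counted in two ways.\<close>

lemma card_perp_duality:
  assumes U: "vec.subspace U" and V: "vec.subspace V"
  shows "card (V \<inter> perp U) * card U = card (U \<inter> perp V) * card V"
proof -
  have "(\<Sum>v\<in>V. card {u\<in>U. B u v = 0}) = (\<Sum>u\<in>U. card {v\<in>V. B u v = 0})"
    by (rule double_count) auto
  also have "\<dots> = (\<Sum>u\<in>U. card {v\<in>V. B v u = 0})" using B_sym by simp
  finally have "card U * (card V + (CARD('f) - 1) * card (V \<inter> perp U))
      = card V * (card U + (CARD('f) - 1) * card (U \<inter> perp V))"
    using card_perp_pairs[OF U, of V] card_perp_pairs[OF V, of U] by simp
  then have "(CARD('f) - 1) * (card U * card (V \<inter> perp U)) = (CARD('f) - 1) * (card V * card (U \<inter> perp V))"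
    by (simp add: algebra_simps)
  then show ?thesis using card_field_ge2[where 'f='f] by (simp add: mult.commute)
qed

lemma dim_perp_duality:
  assumes U: "vec.subspace U" and V: "vec.subspace V"
  shows "vec.dim (V \<inter> perp U) + vec.dim U = vec.dim (U \<inter> perp V) + vec.dim V"
proof -
  have "CARD('f) ^ (vec.dim (V \<inter> perp U) + vec.dim U) = CARD('f) ^ (vec.dim (U \<inter> perp V) + vec.dim V)"
    using card_perp_duality[OF U V] assms subspace_perp
    by (simp add: card_subspace vec.subspace_inter power_add)
  then show ?thesis using card_field_ge2[where 'f='f] by simp
qed

section \<open>Totally isotropic subspaces and the vertices\<close>

lemma TI_D:
  assumes "U \<in> TI"
  shows "vec.subspace U" "u \<in> U \<Longrightarrow> iso u" "U \<subseteq> perp U"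
  using assms by (auto simp: TI_eq perp_def)

lemma TI_subset: "U \<in> TI \<Longrightarrow> vec.subspace W \<Longrightarrow> W \<subseteq> U \<Longrightarrow> W \<in> TI"
  unfolding TI_eq by blast

lemma TI_insert:
  assumes U: "U \<in> TI" and p: "iso p" "p \<in> perp U"
  shows "vec.span (insert p U) \<in> TI"
proof -
  note sU = TI_D(1)[OF U]
  have "vec.span (insert p U) \<subseteq> perp (vec.span (insert p U))"
  proof -
    have "insert p U \<subseteq> perp (insert p U)"
      using p TI_D(3)[OF U] iso_self B_sym by (auto simp: perp_def)
    then have "vec.span (insert p U) \<subseteq> perp (insert p U)"
      by (intro vec.span_minimal subspace_perp)
    then show ?thesis by (simp add: perp_span)
  qed
  moreover have "iso y" if y_in: "y \<in> vec.span (insert p U)" for y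
  proof -
    obtain u a where y: "u \<in> U" "y = u + a *s p" using y_in vec_in_span_insert[OF sU] by blast
    have "B p u = 0" using p y by (auto simp: perp_def)
    then have "B u (a *s p) = 0" using B_sym[of u "a *s p"] by (simp add: B_scale)
    then show ?thesis using y iso_add iso_scale p TI_D(2)[OF U] by blast
  qed
  ultimately show ?thesis by (auto simp: TI_eq perp_def)
qed

lemma zero_TI: "{0} \<in> TI"
  by (simp add: TI_eq iso_0 B_0)

lemma dim_TI_le: "U \<in> TI \<Longrightarrow> vec.dim U \<le> D"
  by (simp add: D_eq)

lemma X_TI: "v \<in> X \<Longrightarrow> v \<in> TI"
  by (simp add: dp_vertices_def)

lemma X_subspace: "v \<in> X \<Longrightarrow> vec.subspace v"
  using X_TI TI_D by blast

text \<open>Otherwise v + <p> would be a strictly larger totally isotropic subspace.\<close>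

lemma X_perp_iso:
  assumes v: "v \<in> X" and p: "iso p" "p \<in> perp v"
  shows "p \<in> v"
proof -
  have "v \<subseteq> vec.span (insert p v)" by (meson subset_insertI vec.span_superset order_trans)
  then have "vec.span (insert p v) = v"
    using v TI_insert[OF X_TI[OF v] p] by (auto simp: dp_vertices_def)
  then show ?thesis by (metis insertI1 vec.span_base)
qed

text \<open>Compare v with some U of the largest dimension D. If dim v < D, duality makes
  \<open>U \<inter> perp v\<close> larger than \<open>v \<inter> perp U\<close>; but vectors of U
  are isotropic, so those orthogonal to v already lie in v.\<close>

lemma dim_X:
  assumes v: "v \<in> X" shows "vec.dim v = D"
proof (rule antisym)
  show "vec.dim v \<le> D" using dim_TI_le X_TI v by blast
  show "D \<le> vec.dim v"
  proof (rule ccontr)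
    assume a: "\<not> D \<le> vec.dim v"
    have "D \<in> vec.dim ` TI"
      unfolding D_eq by (rule Max_in) (use zero_TI in auto)
    then obtain U where U: "U \<in> TI" "vec.dim U = D" by auto
    have sv: "vec.subspace v" "vec.subspace U" using X_subspace v TI_D U by auto
    have "vec.dim (U \<inter> perp v) + vec.dim v = vec.dim (v \<inter> perp U) + D"
      using dim_perp_duality[OF sv] U by simp
    then have "vec.dim (v \<inter> perp U) < vec.dim (U \<inter> perp v)" using a by linarith
    moreover have "U \<inter> perp v \<subseteq> v \<inter> perp U"
      using X_perp_iso[OF v] TI_D(2,3)[OF U(1)] by blast
    ultimately show False using vec.dim_subset by (metis not_less)
  qed
qed

lemma X_iff: "v \<in> X \<longleftrightarrow> v \<in> TI \<and> vec.dim v = D"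
proof
  assume "v \<in> TI \<and> vec.dim v = D"
  then show "v \<in> X"
    unfolding dp_vertices_def
    using TI_D(1) dim_TI_le by (auto dest!: vec.subspace_dim_equal[rotated 2])
qed (simp add: X_TI dim_X)

lemma X_Int_perp: "v \<in> X \<Longrightarrow> U \<in> TI \<Longrightarrow> U \<inter> perp v = U \<inter> v"
  using X_perp_iso TI_D(2,3) X_TI by blast

lemma X_eq_if_subset: "v \<in> X \<Longrightarrow> w \<in> X \<Longrightarrow> v \<subseteq> w \<Longrightarrow> v = w"
  by (simp add: X_iff TI_D(1) vec.subspace_dim_equal)

section \<open>Vertices through a common hyperplane\<close>

lemma X_span_insert:
  assumes H: "H \<in> TI" "vec.dim H = D - 1" and p: "iso p" "p \<in> perp H" "p \<notin> H"
  shows "vec.span (insert p H) \<in> X"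
  using TI_insert[OF H(1) p(1,2)] dim_span_insert[OF TI_D(1)[OF H(1)] p(3)] H(2) D_pos
  by (simp add: X_iff)

lemma X_eq_span_insert:
  assumes v: "v \<in> X" and H: "vec.subspace H" "H \<subseteq> v" "vec.dim H = D - 1" and p: "p \<in> v" "p \<notin> H"
  shows "v = vec.span (insert p H)"
proof -
  have "vec.span (insert p H) \<subseteq> v" using v H p by (simp add: vec.span_minimal X_subspace)
  moreover have "vec.dim (vec.span (insert p H)) = vec.dim v"
    using dim_span_insert[OF H(1) p(2)] H D_pos dim_X[OF v] by simp
  ultimately show ?thesis
    using vec.subspace_dim_equal[of "vec.span (insert p H)" v] X_subspace[OF v] by simp
qed

lemma X_Int_eq_hyperplane:
  assumes v: "v \<in> X" "w \<in> X" "v \<noteq> w" and H: "vec.subspace H" "H \<subseteq> v" "H \<subseteq> w" "vec.dim H = D - 1"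
  shows "v \<inter> w = H"
proof -
  have "p \<in> H" if "p \<in> v \<inter> w" for p
    using that X_eq_span_insert[OF v(1) H(1,2,4)] X_eq_span_insert[OF v(2) H(1,3,4)] v(3) by blast
  then show ?thesis using H by blast
qed

text \<open>The assumption \<open>nondeg\<close> concerns isotropic vectors only, which suffices for
  H to meet the radical trivially, since all of H is isotropic. Duality with the whole space then
  gives the size of \<open>perp H\<close>.\<close>

lemma card_perp_X_subset:
  assumes v: "v \<in> X" and H: "vec.subspace H" "H \<subseteq> v"
  shows "real (card (perp H)) * q ^ vec.dim H = q ^ CARD('n)"
proof -
  have "H \<inter> perp UNIV = {0}"
  proof -
    have "h = 0" if "h \<in> H" "h \<in> perp UNIV" for h
      using that nondeg[of h] TI_D(2)[OF X_TI[OF v]] H(2) by (auto simp: perp_def)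
    moreover have "0 \<in> perp UNIV" by (simp add: perp_def B_0)
    ultimately show ?thesis using vec.subspace_0[OF H(1)] by auto
  qed
  then have "card (perp H) * card H = card (UNIV :: ('f^'n) set)"
    using card_perp_duality[OF H(1), of UNIV] by simp
  then show ?thesis
    using H by (simp add: card_subspace vec_dim_card q_eq flip: of_nat_mult of_nat_power)
qed

text \<open>Count the isotropic vectors of \<open>perp H - perp x\<close> twice. They are
  partitioned by the sets v - H for the vertices v in question; and on each line in the direction of
  a vector z in x outside H, exactly s of the q points are isotropic.\<close>

lemma card_residue:
  assumes x: "x \<in> X" and H: "vec.subspace H" "H \<subseteq> x" "vec.dim H = D - 1"
  shows "real (card {v\<in>X. H \<subseteq> v \<and> v \<noteq> x}) = M"
proof -
  define K where "K = {v\<in>X. H \<subseteq> v \<and> v \<noteq> x}"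
  define Y where "Y = perp H - perp x"
  define P where "P = {p\<in>Y. iso p}"
  have HTI: "H \<in> TI" using TI_subset X_TI x H by blast
  have HneqX: "H \<noteq> x" using H dim_X[OF x] D_pos by auto
  then obtain z where z: "z \<in> x" "z \<notin> H" using H by blast
  have xz: "x = vec.span (insert z H)" using X_eq_span_insert[OF x H] z by blast
  have isoz: "iso z" using z x X_TI TI_D by blast
  have perpx: "perp x = {p\<in>perp H. B p z = 0}" unfolding xz perp_span by (auto simp: perp_def)
  have P_eq: "P = (\<Union>v\<in>K. v - H)"
  proof (intro equalityI subsetI)
    fix p assume "p \<in> P"
    then have p: "iso p" "p \<in> perp H" "p \<notin> perp x" by (auto simp: P_def Y_def)
    then have px: "p \<notin> x" using TI_D(3)[OF X_TI[OF x]] by blast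
    then have pH: "p \<notin> H" using H by blast
    have "vec.span (insert p H) \<in> X" using X_span_insert[OF HTI H(3) p(1,2) pH] .
    moreover have "p \<in> vec.span (insert p H)" "H \<subseteq> vec.span (insert p H)"
      by (auto intro: vec.span_base)
    ultimately show "p \<in> (\<Union>v\<in>K. v - H)" using px pH by (auto simp: K_def)
  next
    fix p assume "p \<in> (\<Union>v\<in>K. v - H)"
    then obtain v where v: "v \<in> X" "H \<subseteq> v" "v \<noteq> x" "p \<in> v" "p \<notin> H" by (auto simp: K_def)
    have "p \<notin> x" using X_Int_eq_hyperplane[OF v(1) x v(3) H(1) v(2) H(2,3)] v by blast
    moreover have "iso p" using v X_TI TI_D by blast
    moreover have "p \<in> perp H" using v TI_D(3)[OF X_TI[OF v(1)]] perp_antimono[OF v(2)] by blast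
    ultimately show "p \<in> P" using X_perp_iso[OF x] by (auto simp: P_def Y_def)
  qed
  have "real (card P) = real (card K) * (q ^ D - q ^ (D - 1))"
  proof -
    have "card P = (\<Sum>v\<in>K. card (v - H))"
      unfolding P_eq
    proof (rule card_UN_disjoint)
      show "\<forall>v\<in>K. \<forall>w\<in>K. v \<noteq> w \<longrightarrow> (v - H) \<inter> (w - H) = {}"
        using X_Int_eq_hyperplane[OF _ _ _ H(1) _ _ H(3)] by (fastforce simp: K_def)
    qed auto
    moreover have "real (card (v - H)) = q ^ D - q ^ (D - 1)" if "v \<in> K" for v
    proof -
      have v: "v \<in> X" "H \<subseteq> v" using that by (auto simp: K_def)
      have "real (card (v - H)) = real (card v) - real (card H)"
        using v by (simp add: card_Diff_subset card_mono of_nat_diff)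
      then show ?thesis using v H by (simp add: card_subspace X_subspace dim_X q_eq)
    qed
    ultimately show ?thesis by simp
  qed
  moreover have "card P * CARD('f) = s * card Y"
  proof -
    \<comment> \<open>z is orthogonal to H and to itself, so translation by multiples of z preserves
      Y. Hence the number of p in Y with \<open>p + a *s z\<close> isotropic is the same for every
      a.\<close>
    have inv: "p + a *s z \<in> Y \<longleftrightarrow> p \<in> Y" for p a
    proof -
      have "B z h = 0" if "h \<in> H" for h
        using that z H(2) TI_D(3)[OF X_TI[OF x]] by (auto simp: perp_def)
      then have "p + a *s z \<in> perp H \<longleftrightarrow> p \<in> perp H"
        by (auto simp: perp_def B_add B_scale)
      moreover have "B (p + a *s z) z = B p z"
        using iso_self[OF isoz] by (simp add: B_add B_scale)
      ultimately show ?thesis unfolding Y_def perpx by auto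
    qed
    have "(\<Sum>p\<in>Y. card {a\<in>UNIV. iso (p + a *s z)}) = (\<Sum>a\<in>UNIV. card {p\<in>Y. iso (p + a *s z)})"
      by (rule double_count) auto
    moreover have "card {a\<in>UNIV. iso (p + a *s z)} = s" if "p \<in> Y" for p
      using iso_count[OF isoz, of p] that by (auto simp: Y_def perpx)
    moreover have "card {p\<in>Y. iso (p + a *s z)} = card P" for a
    proof (rule bij_betw_same_card[of "\<lambda>p. p + a *s z"], rule bij_betwI[where g = "\<lambda>p. p - a *s z"])
      show "(\<lambda>p. p - a *s z) \<in> P \<rightarrow> {p \<in> Y. iso (p + a *s z)}"
        using inv[of "_ - a *s z" a] by (auto simp: P_def)
    qed (auto simp: P_def inv)
    ultimately show ?thesis by (simp add: mult.commute)
  qed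
  then have "real (card P) * q = real s * real (card Y)" by (metis of_nat_mult q_eq)
  moreover have "real (card Y) = q ^ CARD('n) / q ^ (D - 1) - q ^ CARD('n) / q ^ D"
  proof -
    have "real (card Y) = real (card (perp H)) - real (card (perp x))"
      unfolding Y_def using perp_antimono[OF H(2)]
      by (simp add: card_Diff_subset card_mono of_nat_diff)
    moreover have "real (card (perp H)) = q ^ CARD('n) / q ^ (D - 1)"
      using card_perp_X_subset[OF x H(1,2)] H(3) q_ge2 by (simp add: field_simps)
    moreover have "real (card (perp x)) = q ^ CARD('n) / q ^ D"
      using card_perp_X_subset[OF x X_subspace[OF x]] dim_X[OF x] q_ge2 by (simp add: field_simps)
    ultimately show ?thesis by simp
  qed
  ultimately have main: "real (card K) * (q ^ D - q ^ (D - 1)) * q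
      = real s * (q ^ CARD('n) / q ^ (D - 1) - q ^ CARD('n) / q ^ D)"
    by simp
  obtain d where d: "D = Suc d" using D_pos by (metis Suc_le_D One_nat_def)
  define Q N where "Q = q ^ d" and "N = q ^ CARD('n)"
  have Q: "Q > 0" using q_ge2 by (simp add: Q_def)
  have "real (card K) * (q * Q - Q) * q = real s * (N / Q - N / (q * Q))"
    using main by (simp add: d Q_def N_def)
  moreover have "real s * (N / Q - N / (q * Q)) = real s * N * (q - 1) / (q * Q)"
    using Q q_ge2 by (simp add: field_simps)
  moreover have "real (card K) * (q * Q - Q) * q = (real (card K) * q * Q) * (q - 1)"
    by (simp add: algebra_simps)
  ultimately have "(real (card K) * q * Q) * (q - 1) = (real s * N / (q * Q)) * (q - 1)"
    by simp
  then have "real (card K) * q * Q = real s * N / (q * Q)"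
    using q_ge2 by (subst (asm) mult_right_cancel) auto
  then have "real (card K) = real s * N / ((q * Q) * (q * Q))"
    using Q q_ge2 by (simp add: field_simps)
  also have "\<dots> = M"
  proof -
    have "q ^ (2 * D) = (q * Q) * (q * Q)" by (simp add: Q_def d mult_2 power_add)
    then have "real s * N = M * ((q * Q) * (q * Q))" using M_eq by (simp add: N_def)
    then show ?thesis using Q q_ge2 by simp
  qed
  finally show ?thesis by (simp add: K_def)
qed

text \<open>The projection of a vertex from an isotropic point, as in the axioms of a polar space.
  By maximality of v the functional \<open>u \<mapsto> B u p\<close> is not zero on v, so its kernel
  is a hyperplane of v, and this hyperplane together with p spans a vertex.\<close>

lemma perp_point_section:
  assumes v: "v \<in> X" and p: "iso p" "p \<notin> v"
  shows "v \<inter> perp {p} \<in> TI" "vec.subspace (v \<inter> perp {p})" "vec.dim (v \<inter> perp {p}) = D - 1"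
    "p \<in> perp (v \<inter> perp {p})" "vec.span (insert p (v \<inter> perp {p})) \<in> X"
proof -
  let ?H = "v \<inter> perp {p}"
  show sub: "vec.subspace ?H" using X_subspace[OF v] subspace_perp vec.subspace_inter by blast
  then show TI: "?H \<in> TI" using TI_subset[OF X_TI[OF v]] by simp
  have "p \<notin> perp v" using X_perp_iso[OF v p(1)] p(2) by blast
  then obtain w where "w \<in> v" "B w p \<noteq> 0" using B_sym by (auto simp: perp_def)
  then have "card {u\<in>v. B u p = 0} * CARD('f) = card v"
    using card_kernel[OF X_subspace[OF v], of "\<lambda>u. B u p" w] B_add B_scale by simp
  moreover have "{u\<in>v. B u p = 0} = ?H" by (auto simp: perp_def)
  ultimately have "CARD('f) ^ Suc (vec.dim ?H) = CARD('f) ^ D"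
    using card_subspace[OF sub] card_subspace[OF X_subspace[OF v]] dim_X[OF v] by (simp add: mult.commute)
  then show dim: "vec.dim ?H = D - 1"
    using card_field_ge2[where 'f='f] power_inject_exp[of "CARD('f)" "Suc (vec.dim ?H)" D] by simp
  show pp: "p \<in> perp ?H" using perp_sym[THEN iffD1, of "?H" "{p}"] by simp
  show "vec.span (insert p ?H) \<in> X"
    by (rule X_span_insert[OF TI dim p(1) pp]) (use p(2) in simp)
qed

text \<open>The map \<open>v \<mapsto> (v \<inter> perp {p}) + \<langle>p\<rangle>\<close> sends the vertices meeting \<open>x\<close> in \<open>W\<close> to those meeting
  \<open>x\<close> in \<open>W + \<langle>p\<rangle>\<close>; its fibre over \<open>v'\<close> consists of the vertices other than \<open>v'\<close> through a
  complement of \<open>p\<close> in \<open>v'\<close> containing \<open>W\<close>.\<close>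

lemma card_Int_eq_step:
  assumes x: "x \<in> X" and W: "vec.subspace W" "W \<subseteq> x" "vec.dim W = k" and p: "p \<in> x" "p \<notin> W"
  shows "real (card {v\<in>X. v \<inter> x = W})
       = real (card {v\<in>X. v \<inter> x = vec.span (insert p W)}) * (q ^ (D - 1 - k) * M)"
proof -
  let ?Wp = "vec.span (insert p W)"
  define \<Phi> where "\<Phi> v = vec.span (insert p (v \<inter> perp {p}))" for v
  define A where "A = {v\<in>X. v \<inter> x = W}"
  define A' where "A' = {v\<in>X. v \<inter> x = ?Wp}"
  have isop: "iso p" using p x X_TI TI_D by blast
  have xp: "x \<subseteq> perp {p}"
    using p(1) TI_D(3)[OF X_TI[OF x]] by (auto simp: perp_def)
  have Wp: "p \<in> ?Wp" "W \<subseteq> ?Wp" by (auto intro: vec.span_base)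
  have \<Phi>A: "\<Phi> v \<in> A'" if "v \<in> A" for v
  proof -
    have v: "v \<in> X" "v \<inter> x = W" using that by (auto simp: A_def)
    have pv: "p \<notin> v" using v p by blast
    note H = perp_point_section[OF v(1) isop pv]
    have "\<Phi> v \<inter> x = ?Wp"
    proof
      have "W \<subseteq> v \<inter> perp {p}" using v W xp by blast
      then have "insert p W \<subseteq> insert p (v \<inter> perp {p})" by blast
      then have "?Wp \<subseteq> \<Phi> v" unfolding \<Phi>_def by (rule vec.span_mono)
      moreover have "?Wp \<subseteq> x" using W p X_subspace[OF x] by (simp add: vec.span_minimal)
      ultimately show "?Wp \<subseteq> \<Phi> v \<inter> x" by blast
      show "\<Phi> v \<inter> x \<subseteq> ?Wp"
      proof
        fix y assume y: "y \<in> \<Phi> v \<inter> x"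
        then obtain h a where h: "h \<in> v \<inter> perp {p}" "y = h + a *s p"
          using vec_in_span_insert[OF H(2)] by (auto simp: \<Phi>_def)
        have "h = y - a *s p" using h by simp
        then have "h \<in> x" using y p X_subspace[OF x] by (simp add: vec.subspace_diff vec.subspace_scale)
        then have "h \<in> W" using h v by blast
        then show "y \<in> ?Wp" using h vec_in_span_insert[OF W(1)] by blast
      qed
    qed
    then show ?thesis using H(5) by (simp add: A'_def \<Phi>_def)
  qed
  have fibre: "real (card {v\<in>A. \<Phi> v = v'}) = q ^ (D - 1 - k) * M" if v': "v' \<in> A'" for v'
  proof -
    have v'X: "v' \<in> X" and v'x: "v' \<inter> x = ?Wp" using v' by (auto simp: A'_def)
    have pv': "p \<in> v'" and Wv': "W \<subseteq> v'" using v'x Wp by auto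
    define Hs where "Hs = {H. vec.subspace H \<and> H \<subseteq> v' \<and> vec.dim H = D - 1 \<and> p \<notin> H \<and> W \<subseteq> H}"
    \<comment> \<open>A vertex v of the fibre meets v' in the hyperplane
      \<open>v \<inter> perp {p}\<close>, which contains W and avoids p. Conversely, if v differs
      from v' and contains such an H, then \<open>v \<inter> perp {p} = H\<close>, so v is sent to
      v'; and \<open>v \<inter> x\<close> lies in the intersection of H with W + <p>, which is
      W.\<close>
    have eq: "{v\<in>A. \<Phi> v = v'} = (\<Union>H\<in>Hs. {v\<in>X. H \<subseteq> v \<and> v \<noteq> v'})"
    proof (intro equalityI subsetI)
      fix v assume "v \<in> {v\<in>A. \<Phi> v = v'}"
      then have v: "v \<in> X" "v \<inter> x = W" "\<Phi> v = v'" by (auto simp: A_def)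
      have pv: "p \<notin> v" using v p by blast
      note H = perp_point_section[OF v(1) isop pv]
      have "v \<inter> perp {p} \<in> Hs"
        using H pv v W xp unfolding Hs_def \<Phi>_def by (auto intro: vec.span_base)
      then show "v \<in> (\<Union>H\<in>Hs. {v\<in>X. H \<subseteq> v \<and> v \<noteq> v'})" using v pv pv' by blast
    next
      fix v assume "v \<in> (\<Union>H\<in>Hs. {v\<in>X. H \<subseteq> v \<and> v \<noteq> v'})"
      then obtain H where H: "vec.subspace H" "H \<subseteq> v'" "vec.dim H = D - 1" "p \<notin> H" "W \<subseteq> H"
        and v: "v \<in> X" "H \<subseteq> v" "v \<noteq> v'" by (auto simp: Hs_def)
      have vv': "v \<inter> v' = H" using X_Int_eq_hyperplane[OF v(1) v'X v(3) H(1) v(2) H(2,3)] .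
      have pv: "p \<notin> v" using vv' pv' H by blast
      note S = perp_point_section[OF v(1) isop pv]
      have "H \<subseteq> perp {p}" using H(2) pv' TI_D(3)[OF X_TI[OF v'X]] by (auto simp: perp_def)
      then have "H = v \<inter> perp {p}"
        using vec.subspace_dim_equal[OF H(1) S(2)] v S(3) H(3) by auto
      then have HS: "v \<inter> perp {p} = H" by simp
      have \<Phi>v: "\<Phi> v = v'"
        using X_eq_span_insert[OF v'X H(1,2,3) pv' H(4)] by (simp add: \<Phi>_def HS)
      have "y \<in> W" if y: "y \<in> v" "y \<in> x" for y
      proof -
        have yH: "y \<in> H" using y xp HS by blast
        then have "y \<in> ?Wp" using v'x H y by blast
        then obtain w a where w: "w \<in> W" "y = w + a *s p" using vec_in_span_insert[OF W(1)] by blast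
        have "a *s p = y - w" using w by simp
        then have "a *s p \<in> H" using yH w H by (metis subsetD vec.subspace_diff)
        have "a = 0"
        proof (rule ccontr)
          assume "a \<noteq> 0"
          then have "inverse a *s (a *s p) = p"
            by (simp only: vec.scale_scale left_inverse[OF \<open>a \<noteq> 0\<close>] vec.scale_one)
          then show False
            using vec.subspace_scale[OF H(1) \<open>a *s p \<in> H\<close>, of "inverse a"] H(4) by simp
        qed
        then show ?thesis using w by simp
      qed
      then have "v \<inter> x = W" using v H W by blast
      then show "v \<in> {v\<in>A. \<Phi> v = v'}" using v \<Phi>v by (simp add: A_def)
    qed
    have "card {v\<in>A. \<Phi> v = v'} = (\<Sum>H\<in>Hs. card {v\<in>X. H \<subseteq> v \<and> v \<noteq> v'})"
      unfolding eq
    proof (rule card_UN_disjoint)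
      show "\<forall>H\<in>Hs. \<forall>H'\<in>Hs. H \<noteq> H' \<longrightarrow>
          {v\<in>X. H \<subseteq> v \<and> v \<noteq> v'} \<inter> {v\<in>X. H' \<subseteq> v \<and> v \<noteq> v'} = {}"
      proof (intro ballI impI)
        fix H H' assume HH: "H \<in> Hs" "H' \<in> Hs" "H \<noteq> H'"
        \<comment> \<open>The hyperplane is recovered from v as its intersection with v', so
          different hyperplanes give disjoint sets of vertices.\<close>
        have "v \<inter> v' = H''" if "v \<in> X" "H'' \<subseteq> v" "v \<noteq> v'" "H'' \<in> Hs" for v H''
          using X_Int_eq_hyperplane[OF that(1) v'X that(3) _ that(2)] that(4) by (auto simp: Hs_def)
        then show "{v\<in>X. H \<subseteq> v \<and> v \<noteq> v'} \<inter> {v\<in>X. H' \<subseteq> v \<and> v \<noteq> v'} = {}"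
          using HH by blast
      qed
    qed auto
    then have "real (card {v\<in>A. \<Phi> v = v'}) = (\<Sum>H\<in>Hs. real (card {v\<in>X. H \<subseteq> v \<and> v \<noteq> v'}))"
      by simp
    also have "\<dots> = (\<Sum>H\<in>Hs. M)"
      by (rule sum.cong[OF refl], rule card_residue[OF v'X]) (auto simp: Hs_def)
    also have "\<dots> = q ^ (D - 1 - k) * M"
      using card_complements_above[OF X_subspace[OF v'X] dim_X[OF v'X] pv' W(1) Wv' W(3) p(2)]
      by (simp add: Hs_def q_eq)
    finally show ?thesis .
  qed
  have "(\<Sum>v\<in>A. card {v'\<in>A'. \<Phi> v = v'}) = (\<Sum>v'\<in>A'. card {v\<in>A. \<Phi> v = v'})"
    by (rule double_count) auto
  moreover have "card {v'\<in>A'. \<Phi> v = v'} = 1" if "v \<in> A" for v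
  proof -
    have "{v'\<in>A'. \<Phi> v = v'} = {\<Phi> v}" using \<Phi>A[OF that] by blast
    then show ?thesis by simp
  qed
  ultimately have "real (card A) = (\<Sum>v'\<in>A'. real (card {v\<in>A. \<Phi> v = v'}))" by simp
  also have "\<dots> = (\<Sum>v'\<in>A'. q ^ (D - 1 - k) * M)" by (rule sum.cong[OF refl fibre])
  finally show ?thesis by (simp add: A_def A'_def)
qed

text \<open>Enlarge W by one dimension at a time with \<open>card_Int_eq_step\<close> until W = x,
  where v = x is the only vertex. The result depends on W through its dimension alone.\<close>

lemma card_Int_eq:
  assumes x: "x \<in> X" and W: "vec.subspace W" "W \<subseteq> x"
  shows "real (card {v\<in>X. v \<inter> x = W}) = (\<Prod>j=vec.dim W..<D. q ^ (D - 1 - j) * M)"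
proof -
  have "vec.dim W \<le> D" using W vec.dim_subset dim_X[OF x] by metis
  moreover obtain k where k: "vec.dim W = k" by simp
  ultimately have "k \<le> D" by simp
  then show ?thesis using W k
  proof (induction k arbitrary: W rule: inc_induct)
    case base
    then have "W = x" using vec.subspace_dim_equal[of W x] X_subspace[OF x] dim_X[OF x] by simp
    then have "{v\<in>X. v \<inter> x = W} = {x}" using x X_eq_if_subset[OF x] by auto
    then show ?case using base by simp
  next
    case (step k)
    have "W \<noteq> x" using step dim_X[OF x] by auto
    then obtain p where p: "p \<in> x" "p \<notin> W" using step.prems by blast
    have "vec.span (insert p W) \<subseteq> x" using step.prems p X_subspace[OF x] by (simp add: vec.span_minimal)
    moreover have "vec.dim (vec.span (insert p W)) = Suc k"
      using step.prems p dim_span_insert[of W p] by simp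
    ultimately have IH: "real (card {v\<in>X. v \<inter> x = vec.span (insert p W)}) = (\<Prod>j=Suc k..<D. q ^ (D - 1 - j) * M)"
      using step.IH[OF vec.subspace_span] by simp
    have "real (card {v\<in>X. v \<inter> x = W}) = (\<Prod>j=Suc k..<D. q ^ (D - 1 - j) * M) * (q ^ (D - 1 - k) * M)"
      using card_Int_eq_step[OF x step.prems p] unfolding IH .
    also have "\<dots> = (\<Prod>j=k..<D. q ^ (D - 1 - j) * M)"
      using step.hyps by (simp only: prod.atLeast_Suc_lessThan mult.commute)
    finally show ?case by (simp only: step.prems(3))
  qed
qed

section \<open>Distance in the dual polar graph\<close>

abbreviation R where "R \<equiv> dp_adj TI D"

lemma X_Int_subspace: "u \<in> X \<Longrightarrow> v \<in> X \<Longrightarrow> vec.subspace (u \<inter> v)"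
  by (rule vec.subspace_inter) (rule X_subspace, assumption)+

lemma adj_iff: "R u v \<longleftrightarrow> u \<in> X \<and> v \<in> X \<and> vec.dim (u \<inter> v) = D - 1"
  by (simp add: dp_adj_def)

text \<open>Both \<open>u \<inter> w\<close> and the hyperplane \<open>u \<inter> v\<close> lie in
  u, so by the dimension formula they meet in codimension at most one in
  \<open>u \<inter> w\<close>.\<close>

lemma dim_Int_adj_le:
  assumes "R u v" "w \<in> X"
  shows "vec.dim (u \<inter> w) \<le> vec.dim (v \<inter> w) + 1"
proof -
  have u: "u \<in> X" and v: "v \<in> X" and uv: "vec.dim (u \<inter> v) = D - 1" using assms by (auto simp: adj_iff)
  note sub = X_Int_subspace[OF u assms(2)] X_Int_subspace[OF u v]
  let ?S = "{a + b | a b. a \<in> u \<inter> w \<and> b \<in> u \<inter> v}"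
  have "vec.dim ?S + vec.dim ((u \<inter> w) \<inter> (u \<inter> v)) = vec.dim (u \<inter> w) + vec.dim (u \<inter> v)"
    using vec.dim_sums_Int[OF sub] .
  moreover have "?S \<subseteq> u" using vec.subspace_add[OF X_subspace[OF u]] by blast
  from vec.dim_subset[OF this] have "vec.dim ?S \<le> D" by (simp only: dim_X[OF u])
  moreover have "vec.dim ((u \<inter> w) \<inter> (u \<inter> v)) \<le> vec.dim (v \<inter> w)"
    by (rule vec.dim_subset) blast
  ultimately show ?thesis using D_pos unfolding uv by linarith
qed

lemma relpow_dim_Int:
  assumes "(R ^^ k) u w" "u \<in> X" "w \<in> X"
  shows "D - vec.dim (u \<inter> w) \<le> k"
  using assms
proof (induction k arbitrary: u)
  case 0
  then have "w = u" by simp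
  then show ?case using dim_X[OF 0(2)] by simp
next
  case (Suc k)
  obtain v where v: "R u v" "(R ^^ k) v w" using relpowp_Suc_E2[OF Suc.prems(1)] by blast
  have vX: "v \<in> X" using v(1) unfolding adj_iff by blast
  have "D - vec.dim (v \<inter> w) \<le> k" using Suc.IH[OF v(2) vX Suc.prems(3)] .
  moreover have "vec.dim (v \<inter> w) \<le> vec.dim (u \<inter> w) + 1"
  proof -
    have "R v u" using v(1) unfolding adj_iff by (simp add: Int_commute)
    then show ?thesis using dim_Int_adj_le Suc.prems(3) by blast
  qed
  ultimately show ?case by simp
qed

text \<open>Project u from a point p of w outside u. The new vertex is adjacent to u, keeps
  \<open>u \<inter> w\<close> because w is orthogonal to p, and gains p. A bound on the length is
  enough here: \<open>relpow_dim_Int\<close> supplies the reverse inequality.\<close>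

lemma exists_relpow:
  assumes "u \<in> X" "w \<in> X"
  shows "\<exists>k \<le> D - vec.dim (u \<inter> w). (R ^^ k) u w"
  using assms
proof (induction "D - vec.dim (u \<inter> w)" arbitrary: u rule: less_induct)
  case less
  show ?case
  proof (cases "w \<subseteq> u")
    case True
    then have "u = w" using X_eq_if_subset less.prems by blast
    then show ?thesis by (intro exI[of _ 0]) simp
  next
    case False
    then obtain p where p: "p \<in> w" "p \<notin> u" by blast
    have isop: "iso p" using p less.prems X_TI TI_D by blast
    note H = perp_point_section[OF less.prems(1) isop p(2)]
    let ?u = "vec.span (insert p (u \<inter> perp {p}))"
    have "p \<in> ?u" by (rule vec.span_base) simp
    then have ne: "?u \<noteq> u" using p by blast
    have "u \<inter> perp {p} \<subseteq> ?u" by (auto intro: vec.span_base)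
    then have "u \<inter> ?u = u \<inter> perp {p}"
      using X_Int_eq_hyperplane[OF less.prems(1) H(5) ne[symmetric] H(2) _ _ H(3)] by blast
    then have adj: "R u ?u" unfolding adj_iff using H(3,5) less.prems(1) by simp
    note wsub = X_Int_subspace[OF less.prems]
    have "w \<subseteq> perp {p}"
      using p(1) TI_D(3)[OF X_TI[OF less.prems(2)]] by (auto simp: perp_def)
    then have "insert p (u \<inter> w) \<subseteq> insert p (u \<inter> perp {p})" by blast
    then have "vec.span (insert p (u \<inter> w)) \<subseteq> ?u" by (rule vec.span_mono)
    moreover have "vec.span (insert p (u \<inter> w)) \<subseteq> w"
      using p X_subspace[OF less.prems(2)] by (simp add: vec.span_minimal)
    ultimately have "vec.dim (vec.span (insert p (u \<inter> w))) \<le> vec.dim (?u \<inter> w)"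
      by (intro vec.dim_subset) blast
    then have dimlt: "vec.dim (u \<inter> w) < vec.dim (?u \<inter> w)"
      using dim_span_insert[OF wsub, of p] p by simp
    have "vec.dim (?u \<inter> w) \<le> D"
      using vec.dim_subset[of "?u \<inter> w" w] dim_X[OF less.prems(2)] by auto
    with dimlt have lt: "D - vec.dim (?u \<inter> w) < D - vec.dim (u \<inter> w)" by simp
    from less.hyps[OF lt H(5) less.prems(2)] obtain k
      where k: "k \<le> D - vec.dim (?u \<inter> w)" "(R ^^ k) ?u w" by blast
    have "(R ^^ Suc k) u w" using relpowp_Suc_I2[OF adj k(2)] .
    then show ?thesis using k lt by (intro exI[of _ "Suc k"]) simp
  qed
qed

lemma gdist_eq:
  assumes "u \<in> X" "w \<in> X"
  shows "gdist R u w = D - vec.dim (u \<inter> w)"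
proof -
  obtain k where k: "k \<le> D - vec.dim (u \<inter> w)" "(R ^^ k) u w" using exists_relpow assms by blast
  have "k = D - vec.dim (u \<inter> w)" using relpow_dim_Int[OF k(2) assms] k(1) by (rule antisym[rotated])
  show ?thesis unfolding gdist_def
  proof (rule Least_equality)
    show "(R ^^ (D - vec.dim (u \<inter> w))) u w" using k(2) \<open>k = _\<close> by simp
    show "D - vec.dim (u \<inter> w) \<le> j" if "(R ^^ j) u w" for j
      using relpow_dim_Int[OF that assms] .
  qed
qed

text \<open>Two distinct members x and y meet in a hyperplane E. Every further member must contain
  E, and all vertices through E form a clique, so maximality gives equality.\<close>

lemma maximal_clique_eq:
  assumes C: "is_maximal_clique R X C" and x: "x \<in> C"
  shows "\<exists>E. vec.subspace E \<and> E \<subseteq> x \<and> vec.dim E = D - 1 \<and> C = {v\<in>X. E \<subseteq> v}"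
proof -
  have CX: "C \<subseteq> X" and cl: "\<And>u v. u \<in> C \<Longrightarrow> v \<in> C \<Longrightarrow> u \<noteq> v \<Longrightarrow> R u v"
    and mx: "\<And>C'. is_clique R X C' \<Longrightarrow> C \<subseteq> C' \<Longrightarrow> C' = C"
    using C by (auto simp: is_maximal_clique_def is_clique_def)
  have xX: "x \<in> X" using x CX by blast
  have clique: "is_clique R X {v\<in>X. E \<subseteq> v}" if E: "vec.subspace E" "vec.dim E = D - 1" for E
    unfolding is_clique_def adj_iff
  proof (intro conjI ballI impI)
    fix u v assume "u \<in> {v\<in>X. E \<subseteq> v}" "v \<in> {v\<in>X. E \<subseteq> v}" "u \<noteq> v"
    then show "vec.dim (u \<inter> v) = D - 1"
      using X_Int_eq_hyperplane[of u v E] E by simp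
  qed auto
  \<comment> \<open>A single vertex is not a maximal clique: M > 0 provides another vertex through
    any of its hyperplanes.\<close>
  obtain y where y: "y \<in> C" "y \<noteq> x"
  proof (rule ccontr)
    assume "\<not> thesis"
    then have Cx: "C = {x}" using x that by blast
    have "D - 1 \<le> vec.dim x" using dim_X[OF xX] by simp
    then obtain E where E: "vec.subspace E" "E \<subseteq> vec.span x" "vec.dim E = D - 1"
      by (rule vec.choose_subspace_of_subspace)
    then have Ex: "E \<subseteq> x" using X_subspace[OF xX] vec.span_eq_iff by blast
    have "{v\<in>X. E \<subseteq> v} = {x}" using mx[OF clique[OF E(1,3)]] Ex xX Cx by blast
    then have "{v\<in>X. E \<subseteq> v \<and> v \<noteq> x} = {}" by blast
    then have "M = 0" unfolding card_residue[OF xX E(1) Ex E(3), symmetric] by (simp only: card.empty of_nat_0)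
    then show False using M_pos by simp
  qed
  have yX: "y \<in> X" using y CX by blast
  define E where "E = x \<inter> y"
  have E: "vec.subspace E" "E \<subseteq> x" "vec.dim E = D - 1"
    using cl[OF x y(1)] y X_Int_subspace[OF xX yX] by (auto simp: E_def adj_iff)
  have "E \<subseteq> z" if z: "z \<in> C" for z
  proof (rule ccontr)
    assume n: "\<not> E \<subseteq> z"
    then have zne: "z \<noteq> x" "z \<noteq> y" by (auto simp: E_def)
    have zX: "z \<in> X" using z CX by blast
    obtain p where p: "p \<in> x" "p \<in> y" "p \<notin> z" using n by (auto simp: E_def)
    have isop: "iso p" using p xX X_TI TI_D by blast
    note S = perp_point_section[OF zX isop p(3)]
    \<comment> \<open>A member w containing p lies in \<open>perp {p}\<close>, and both sides have
      dimension D - 1. Applied to x and y this yields \<open>x \<inter> z = y \<inter> z\<close>,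
      which is then contained in E and of the same dimension, contradicting that z misses p.\<close>
    have sect: "w \<inter> z = z \<inter> perp {p}" if w: "w \<in> C" "w \<noteq> z" "p \<in> w" for w
    proof -
      have wX: "w \<in> X" using w CX by blast
      have "w \<subseteq> perp {p}"
        using w(3) TI_D(3)[OF X_TI[OF wX]] by (auto simp: perp_def)
      moreover have "vec.dim (w \<inter> z) = D - 1" using cl[OF w(1) z w(2)] by (simp add: adj_iff)
      moreover note X_Int_subspace[OF wX zX]
      ultimately show ?thesis
        using vec.subspace_dim_equal[of "w \<inter> z" "z \<inter> perp {p}"] S(2,3) by auto
    qed
    have "x \<inter> z = y \<inter> z" using sect[OF x] sect[OF y(1)] zne p by simp
    then have "x \<inter> z \<subseteq> E" by (auto simp: E_def)
    moreover have "vec.dim (x \<inter> z) = D - 1" using cl[OF x z] zne by (simp add: adj_iff)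
    moreover note X_Int_subspace[OF xX zX]
    ultimately have "x \<inter> z = E" using vec.subspace_dim_equal[of "x \<inter> z" E] E by simp
    then show False using n by blast
  qed
  then have "C \<subseteq> {v\<in>X. E \<subseteq> v}" using CX by blast
  then have "C = {v\<in>X. E \<subseteq> v}" using mx[OF clique[OF E(1,3)]] by simp
  then show ?thesis using E by blast
qed

end

section \<open>Maximal cliques\<close>

locale polar_clique = polar B iso s TI D q M
  for B :: "'f::{field,finite}^'n \<Rightarrow> 'f^'n \<Rightarrow> 'f" and iso s TI D q M +
  fixes x E :: "('f^'n) set"
  assumes x_X: "x \<in> X" and E_sub: "vec.subspace E" and E_x: "E \<subseteq> x" and dim_E: "vec.dim E = D - 1"
begin

abbreviation C where "C \<equiv> {v\<in>X. E \<subseteq> v}"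

lemma E_TI: "E \<in> TI"
  by (rule TI_subset[OF X_TI[OF x_X] E_sub E_x])

lemma E_Int_sub: "v \<in> X \<Longrightarrow> vec.subspace (E \<inter> v)"
  by (intro vec.subspace_inter E_sub X_subspace)

lemma dim_E_Int_le: "vec.dim (E \<inter> v) \<le> D - 1"
  using vec.dim_subset[of "E \<inter> v" E] dim_E by simp

text \<open>Duality for E and v, where \<open>E \<inter> perp v\<close> is
  \<open>E \<inter> v\<close> since v is maximal. The one extra dimension singles out the member of
  the clique nearest to v.\<close>

lemma dim_Int_perp_E:
  assumes "v \<in> X"
  shows "vec.dim (v \<inter> perp E) = vec.dim (E \<inter> v) + 1"
proof -
  have "vec.dim (v \<inter> perp E) + (D - 1) = vec.dim (E \<inter> v) + D"
    using dim_perp_duality[OF E_sub X_subspace[OF assms]]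
    by (simp only: dim_E dim_X[OF assms] X_Int_perp[OF assms E_TI])
  then show ?thesis using D_pos by linarith
qed

lemma Int_subset_perp_E:
  assumes "y \<in> C" shows "y \<inter> v \<subseteq> v \<inter> perp E"
proof -
  have "y \<subseteq> perp y" using assms by (intro TI_D(3) X_TI) simp
  also have "perp y \<subseteq> perp E" by (rule perp_antimono) (use assms in simp)
  finally show ?thesis by blast
qed

text \<open>\<open>y \<inter> v\<close> lies between \<open>E \<inter> v\<close> and
  \<open>v \<inter> perp E\<close>, whose dimensions differ by one.\<close>

lemma dim_Int_clique:
  assumes y: "y \<in> C" and v: "v \<in> X"
  shows "vec.dim (y \<inter> v) = vec.dim (E \<inter> v) + (if y \<inter> v \<subseteq> E then 0 else 1)"
proof (cases "y \<inter> v \<subseteq> E")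
  case True
  then have "y \<inter> v = E \<inter> v" using y by blast
  then show ?thesis using True by simp
next
  case False
  have yX: "y \<in> X" using y by simp
  have sub: "E \<inter> v \<subseteq> y \<inter> v" using y by blast
  have "vec.dim (y \<inter> v) \<le> vec.dim (E \<inter> v) + 1"
    using vec.dim_subset[OF Int_subset_perp_E[OF y, of v]] by (simp only: dim_Int_perp_E[OF v])
  moreover have "\<not> vec.dim (y \<inter> v) \<le> vec.dim (E \<inter> v)"
    using vec.subspace_dim_equal[OF E_Int_sub[OF v] X_Int_subspace[OF yX v] sub] False by blast
  ultimately show ?thesis using False by simp
qed

text \<open>The condition says that y is at minimal distance from v, as \<open>gdist_clique\<close>
  and \<open>set_dist_clique\<close> will show. For existence take y = E + <p> with p in
  \<open>v \<inter> perp E\<close> outside E. For uniqueness, any such y meets v in all of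
  \<open>v \<inter> perp E\<close>, so it contains p.\<close>

lemma nearest_in_clique:
  assumes v: "v \<in> X"
  shows "\<exists>!y. y \<in> C \<and> \<not> y \<inter> v \<subseteq> E"
proof -
  have "\<not> v \<inter> perp E \<subseteq> E \<inter> v"
    using vec.dim_subset[of "v \<inter> perp E" "E \<inter> v"] dim_Int_perp_E[OF v] by linarith
  then obtain p where p: "p \<in> v" "p \<in> perp E" "p \<notin> E" by blast
  have isop: "iso p" using TI_D(2)[OF X_TI[OF v] p(1)] .
  let ?y = "vec.span (insert p E)"
  have yX: "?y \<in> X" by (rule X_span_insert[OF E_TI dim_E isop p(2,3)])
  have py: "p \<in> ?y" "E \<subseteq> ?y" by (auto intro: vec.span_base)
  show ?thesis
  proof (rule ex1I[of _ ?y])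
    show "?y \<in> C \<and> \<not> ?y \<inter> v \<subseteq> E" using yX py p by blast
  next
    fix z assume z: "z \<in> C \<and> \<not> z \<inter> v \<subseteq> E"
    then have zX: "z \<in> X" and zC: "z \<in> C" and Ez: "E \<subseteq> z" by auto
    have "vec.dim (z \<inter> v) = vec.dim (v \<inter> perp E)"
      using dim_Int_clique[OF zC v] z by (simp add: dim_Int_perp_E[OF v])
    then have "z \<inter> v = v \<inter> perp E"
      using vec.subspace_dim_equal[OF X_Int_subspace[OF zX v]
          vec.subspace_inter[OF X_subspace[OF v] subspace_perp] Int_subset_perp_E[OF zC]] by simp
    then have "p \<in> z" using p by blast
    then show "z = ?y" using X_eq_span_insert[OF zX E_sub Ez dim_E _ p(3)] by blast
  qed
qed

lemma gdist_clique:
  assumes y: "y \<in> C" and v: "v \<in> X"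
  shows "gdist R y v = D - 1 - vec.dim (E \<inter> v) + (if y \<inter> v \<subseteq> E then 1 else 0)"
proof -
  have yX: "y \<in> X" using y by simp
  show ?thesis
    using gdist_eq[OF yX v] dim_Int_clique[OF y v] dim_E_Int_le[of v] D_pos by auto
qed

lemma set_dist_clique:
  assumes v: "v \<in> X"
  shows "set_dist R C v = D - 1 - vec.dim (E \<inter> v)"
  unfolding set_dist_def
proof (rule Least_equality)
  obtain y where "y \<in> C" "\<not> y \<inter> v \<subseteq> E" using nearest_in_clique[OF v] by blast
  then show "\<exists>c\<in>C. gdist R c v = D - 1 - vec.dim (E \<inter> v)"
    using gdist_clique[OF _ v, of y] by (intro bexI[of _ y]) auto
next
  fix k assume "\<exists>c\<in>C. gdist R c v = k"
  then obtain c where "c \<in> C" "gdist R c v = k" by blast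
  then show "D - 1 - vec.dim (E \<inter> v) \<le> k" using gdist_clique[OF _ v, of c] by auto
qed

lemma x_C: "x \<in> C"
  using x_X E_x by simp

section \<open>Counting vertices by their intersection with a member of the clique\<close>

lemma card_C: "real (card C) = M + 1"
proof -
  have "C = insert x {v\<in>X. E \<subseteq> v \<and> v \<noteq> x}" using x_X E_x by blast
  then have "card C = Suc (card {v\<in>X. E \<subseteq> v \<and> v \<noteq> x})"
    by (simp only:) (rule card_insert_disjoint, auto)
  then show ?thesis using card_residue[OF x_X E_sub E_x dim_E] by simp
qed

text \<open>Vertices are sorted by W = \<open>v \<inter> y\<close>, and by
  \<open>card_Int_eq\<close> every W of dimension k carries equally many. The predicate P is used
  for containment in E and for its negation.\<close>

lemma card_Int_class:
  assumes y: "y \<in> X"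
  shows "real (card {v\<in>X. vec.dim (v \<inter> y) = k \<and> P (v \<inter> y)})
    = real (card {W. vec.subspace W \<and> W \<subseteq> y \<and> vec.dim W = k \<and> P W}) * (\<Prod>j=k..<D. q ^ (D - 1 - j) * M)"
proof -
  let ?Ws = "{W. vec.subspace W \<and> W \<subseteq> y \<and> vec.dim W = k \<and> P W}"
  have "{v\<in>X. vec.dim (v \<inter> y) = k \<and> P (v \<inter> y)} = (\<Union>W\<in>?Ws. {v\<in>X. v \<inter> y = W})"
    using X_Int_subspace[OF _ y] by auto
  then have "card {v\<in>X. vec.dim (v \<inter> y) = k \<and> P (v \<inter> y)} = (\<Sum>W\<in>?Ws. card {v\<in>X. v \<inter> y = W})"
    by (simp only:) (rule card_UN_disjoint, auto)
  then have "real (card {v\<in>X. vec.dim (v \<inter> y) = k \<and> P (v \<inter> y)}) = (\<Sum>W\<in>?Ws. real (card {v\<in>X. v \<inter> y = W}))"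
    by (simp only: of_nat_sum)
  also have "\<dots> = (\<Sum>W\<in>?Ws. \<Prod>j=k..<D. q ^ (D - 1 - j) * M)"
    by (rule sum.cong[OF refl]) (auto simp: card_Int_eq[OF y])
  finally show ?thesis by simp
qed

lemma card_subspaces_dim:
  assumes y: "y \<in> X" and k: "k \<le> D"
  shows "real (card {W. vec.subspace W \<and> W \<subseteq> y \<and> vec.dim W = k})
    = (\<Prod>j=0..<k. (q ^ D - q ^ j) / (q ^ k - q ^ j))"
proof -
  have "{W. vec.subspace W \<and> W \<subseteq> y \<and> vec.dim W = k}
      = {W. vec.subspace W \<and> W \<subseteq> y \<and> vec.dim W = k \<and> {0} \<subseteq> W}"
    using vec.subspace_0 by blast
  then show ?thesis
    using card_subspaces_between[OF X_subspace[OF y] dim_X[OF y], of "{0}" 0 k] k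
      vec.subspace_0[OF X_subspace[OF y]]
    by (simp add: q_eq)
qed

lemma card_subspaces_not_in_E:
  assumes y: "y \<in> C"
  shows "real (card {W. vec.subspace W \<and> W \<subseteq> y \<and> vec.dim W = k \<and> \<not> W \<subseteq> E})
    = real (card {W. vec.subspace W \<and> W \<subseteq> y \<and> vec.dim W = k})
      - real (card {W. vec.subspace W \<and> W \<subseteq> E \<and> vec.dim W = k})"
proof -
  let ?A = "{W. vec.subspace W \<and> W \<subseteq> y \<and> vec.dim W = k}"
  let ?B = "{W. vec.subspace W \<and> W \<subseteq> E \<and> vec.dim W = k}"
  have sub: "?B \<subseteq> ?A" using y by blast
  have "{W. vec.subspace W \<and> W \<subseteq> y \<and> vec.dim W = k \<and> \<not> W \<subseteq> E} = ?A - ?B" by blast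
  then have "card {W. vec.subspace W \<and> W \<subseteq> y \<and> vec.dim W = k \<and> \<not> W \<subseteq> E} = card ?A - card ?B"
    using card_Diff_subset[OF _ sub] by simp
  then show ?thesis using card_mono[OF _ sub] by (simp add: of_nat_diff)
qed

text \<open>The point is that y does not occur on the right, so every member of the clique is
  nearest to equally many vertices at distance i. The condition on v says that
  \<open>v \<inter> y\<close> has dimension D - i and is not contained in E.\<close>

lemma card_nearest:
  assumes y: "y \<in> C" and i: "i < D"
  shows "real (card {v\<in>X. set_dist R C v = i \<and> \<not> y \<inter> v \<subseteq> E})
    = ((\<Prod>j=0..<D - i. (q ^ D - q ^ j) / (q ^ (D - i) - q ^ j))
        - real (card {W. vec.subspace W \<and> W \<subseteq> E \<and> vec.dim W = D - i}))
      * (\<Prod>j=D - i..<D. q ^ (D - 1 - j) * M)"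
proof -
  have yX: "y \<in> X" using y by simp
  have "(set_dist R C v = i \<and> \<not> y \<inter> v \<subseteq> E) = (vec.dim (v \<inter> y) = D - i \<and> \<not> v \<inter> y \<subseteq> E)"
    if v: "v \<in> X" for v
    using set_dist_clique[OF v] dim_Int_clique[OF y v] dim_E_Int_le[of v] i D_pos
    by (auto simp: Int_commute)
  then have "{v\<in>X. set_dist R C v = i \<and> \<not> y \<inter> v \<subseteq> E} = {v\<in>X. vec.dim (v \<inter> y) = D - i \<and> \<not> v \<inter> y \<subseteq> E}"
    by blast
  then show ?thesis
    using card_Int_class[OF yX, of "D - i" "\<lambda>W. \<not> W \<subseteq> E"] card_subspaces_not_in_E[OF y, of "D - i"]
      card_subspaces_dim[OF yX, of "D - i"] by simp
qed

text \<open>The index in the ordered basis of the cell \<open>C\<^sub>i\<^sup>\<plusminus>\<close> containing \<open>v\<close>.\<close>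

definition pos ::"('f^'n) set \<Rightarrow> nat" where
  "pos v = 2 * set_dist R C v + (if x \<inter> v \<subseteq> E then 1 else 0)"

definition cnt :: "nat \<Rightarrow> nat" where
  "cnt r = card {v\<in>X. pos v = r}"

lemma pos_div_2: "pos v div 2 = set_dist R C v"
  by (simp add: pos_def)

text \<open>The distances to x and to the clique differ by the last summand of \<open>pos\<close>.
  Thus halving \<open>pos v\<close> gives the blocks of T, and halving after adding one joins
  \<open>C_(i-1)^+\<close> with \<open>C_i^-\<close>, as in the blocks of T'.\<close>

lemma pos_Suc_div_2: "v \<in> X \<Longrightarrow> (pos v + 1) div 2 = gdist R x v"
  using gdist_clique[OF x_C] set_dist_clique by (simp add: pos_def)

lemma pos_less: "v \<in> X \<Longrightarrow> pos v < 2 * D"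
  using set_dist_clique[of v] D_pos by (auto simp: pos_def)

lemma basis_vec_pos: "basis_vec R X x C r v = (if v \<in> X \<and> pos v = r then 1 else 0)"
proof (cases "v \<in> X")
  case True
  have g: "gdist R x v = set_dist R C v + (if x \<inter> v \<subseteq> E then 1 else 0)"
    using gdist_clique[OF x_C True] set_dist_clique[OF True] by simp
  show ?thesis
  proof (cases "even r")
    case True
    then obtain i where "r = 2 * i" by (rule evenE)
    then show ?thesis
      using \<open>v \<in> X\<close> by (simp add: basis_vec_def charvec_def Cminus_def pos_def g) presburger
  next
    case False
    then obtain i where "r = 2 * i + 1" by (rule oddE)
    then show ?thesis
      using \<open>v \<in> X\<close> by (simp add: basis_vec_def charvec_def Cplus_def pos_def g) presburger
  qed
next
  case False
  then show ?thesis by (simp add: basis_vec_def charvec_def Cminus_def Cplus_def)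
qed

lemma cnt_even: "cnt (2 * i) = card {v\<in>X. set_dist R C v = i \<and> \<not> x \<inter> v \<subseteq> E}"
proof -
  have "pos v = 2 * i \<longleftrightarrow> set_dist R C v = i \<and> \<not> x \<inter> v \<subseteq> E" for v
    by (cases "x \<inter> v \<subseteq> E"; simp add: pos_def; presburger)
  then show ?thesis by (simp only: cnt_def)
qed

lemma cnt_odd: "cnt (2 * i + 1) = card {v\<in>X. set_dist R C v = i \<and> x \<inter> v \<subseteq> E}"
proof -
  have "pos v = 2 * i + 1 \<longleftrightarrow> set_dist R C v = i \<and> x \<inter> v \<subseteq> E" for v
    by (cases "x \<inter> v \<subseteq> E"; simp add: pos_def; presburger)
  then show ?thesis by (simp only: cnt_def)
qed

text \<open>Each vertex has a unique nearest vertex in the clique, and every vertex of the clique is nearest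
  to equally many vertices at a given distance.\<close>

lemma cnt_set_dist_block:
  assumes i: "i < D"
  shows "real (cnt (2 * i + 1)) = M * real (cnt (2 * i))"
proof -
  define S where "S y = {v\<in>X. set_dist R C v = i \<and> \<not> y \<inter> v \<subseteq> E}" for y
  have "{v\<in>X. set_dist R C v = i} = (\<Union>y\<in>C. S y)"
  proof (intro equalityI subsetI)
    fix v assume v: "v \<in> {v\<in>X. set_dist R C v = i}"
    then obtain y where "y \<in> C" "\<not> y \<inter> v \<subseteq> E" using nearest_in_clique[of v] by blast
    then have "v \<in> S y" using v by (simp add: S_def)
    then show "v \<in> (\<Union>y\<in>C. S y)" using \<open>y \<in> C\<close> by blast
  qed (auto simp: S_def)
  moreover have "card (\<Union>y\<in>C. S y) = (\<Sum>y\<in>C. card (S y))"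
  proof (rule card_UN_disjoint)
    show "\<forall>y\<in>C. \<forall>z\<in>C. y \<noteq> z \<longrightarrow> S y \<inter> S z = {}"
    proof (intro ballI impI)
      fix y z assume yz: "y \<in> C" "z \<in> C" "y \<noteq> z"
      show "S y \<inter> S z = {}"
      proof (rule ccontr)
        assume "S y \<inter> S z \<noteq> {}"
        then obtain v where "v \<in> X" "\<not> y \<inter> v \<subseteq> E" "\<not> z \<inter> v \<subseteq> E" by (auto simp: S_def)
        then show False using nearest_in_clique[of v] yz by blast
      qed
    qed
  qed auto
  ultimately have "real (card {v\<in>X. set_dist R C v = i}) = (\<Sum>y\<in>C. real (card (S y)))"
    by simp
  also have "\<dots> = (\<Sum>y\<in>C. real (card (S x)))"
    by (rule sum.cong[OF refl]) (simp only: S_def card_nearest[OF _ i] card_nearest[OF x_C i])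
  also have "\<dots> = (M + 1) * real (card (S x))"
    by (simp only: sum_constant card_C)
  \<comment> \<open>\<open>S x\<close> is the cell \<open>C_i^-\<close>: the distance to x equals
    the distance to the clique exactly when x is the nearest member.\<close>
  also have "card (S x) = cnt (2 * i)" by (simp add: S_def cnt_even)
  finally have "real (card {v\<in>X. set_dist R C v = i}) = (M + 1) * real (cnt (2 * i))" .
  moreover have "card {v\<in>X. set_dist R C v = i} = cnt (2 * i) + cnt (2 * i + 1)"
  proof -
    have "{v\<in>X. set_dist R C v = i} = {v\<in>X. set_dist R C v = i \<and> \<not> x \<inter> v \<subseteq> E}
        \<union> {v\<in>X. set_dist R C v = i \<and> x \<inter> v \<subseteq> E}" by blast
    then show ?thesis unfolding cnt_even cnt_odd
      by (simp only:) (rule card_Un_disjoint, auto)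
  qed
  ultimately show ?thesis by (simp add: algebra_simps)
qed

text \<open>The two cells together form the set at distance i from x, where
  \<open>x \<inter> v\<close> has dimension D - i; it lies in E for the first cell and not for the
  second. Both counts carry the same factor for the vertices over a given intersection, so their
  ratio is that of the subspaces inside and outside the hyperplane E.\<close>

lemma cnt_gdist_block:
  assumes i: "1 \<le> i" "i < D"
  shows "real (cnt (2 * i - 1)) * (q ^ D - q ^ i) = real (cnt (2 * i)) * (q ^ i - 1)"
proof -
  let ?a = "real (card {W. vec.subspace W \<and> W \<subseteq> x \<and> vec.dim W = D - i})"
  let ?b = "real (card {W. vec.subspace W \<and> W \<subseteq> E \<and> vec.dim W = D - i})"
  let ?N = "\<Prod>j=D - i..<D. q ^ (D - 1 - j) * M"
  have even: "real (cnt (2 * i)) = (?a - ?b) * ?N"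
    using card_nearest[OF x_C i(2)] card_subspaces_dim[OF x_X, of "D - i"] by (simp add: cnt_even)
  have "(set_dist R C v = i - 1 \<and> x \<inter> v \<subseteq> E) = (vec.dim (v \<inter> x) = D - i \<and> v \<inter> x \<subseteq> E)"
    if v: "v \<in> X" for v
    using set_dist_clique[OF v] dim_Int_clique[OF x_C v] dim_E_Int_le[of v] i D_pos
    by (auto simp: Int_commute)
  then have "{v\<in>X. set_dist R C v = i - 1 \<and> x \<inter> v \<subseteq> E} = {v\<in>X. vec.dim (v \<inter> x) = D - i \<and> v \<inter> x \<subseteq> E}"
    by blast
  moreover have "{W. vec.subspace W \<and> W \<subseteq> x \<and> vec.dim W = D - i \<and> W \<subseteq> E}
      = {W. vec.subspace W \<and> W \<subseteq> E \<and> vec.dim W = D - i}"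
    using E_x by blast
  moreover have "2 * i - 1 = 2 * (i - 1) + 1" using i by simp
  ultimately have odd: "real (cnt (2 * i - 1)) = ?b * ?N"
    using card_Int_class[OF x_X, of "D - i" "\<lambda>W. W \<subseteq> E"] cnt_odd[of "i - 1"] by simp
  have "?b * (q ^ D - 1) = ?a * (q ^ i - 1)"
    using card_subspaces_hyperplane_ratio[OF X_subspace[OF x_X] dim_X[OF x_X] E_sub dim_E, of "D - i"] i
    by (simp add: q_eq)
  then have "?b * (q ^ D - q ^ i) = (?a - ?b) * (q ^ i - 1)" by (simp add: algebra_simps)
  then have "?N * (?b * (q ^ D - q ^ i)) = ?N * ((?a - ?b) * (q ^ i - 1))" by (rule arg_cong)
  then show ?thesis unfolding even odd by (simp only: mult_ac)
qed

end

section \<open>Projections onto block-constant functions\<close>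

text \<open>Level sets are disjoint, so the span of their characteristic vectors consists of the
  functions that vanish off X and are constant on each level. Orthogonality of the residue
  prescribes the sum over each level, which leaves only the average.\<close>

lemma orth_proj_levels:
  fixes f :: "'a \<Rightarrow> nat" and w :: "'a \<Rightarrow> complex"
  assumes fin: "finite X" and f: "\<And>v. v \<in> X \<Longrightarrow> f v \<le> m"
  shows "orth_proj X {charvec {v\<in>X. f v = i} | i. i \<le> m} w
    = (\<lambda>v. if v \<in> X then (\<Sum>u\<in>{u\<in>X. f u = f v}. w u) / of_nat (card {u\<in>X. f u = f v}) else 0)"
    (is "orth_proj X ?G w = ?p")
proof -
  define L where "L i = {v\<in>X. f v = i}" for i
  have ip: "herm_ip X h (charvec (L i)) = (\<Sum>u\<in>L i. h u)" for h i
  proof -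
    have "herm_ip X h (charvec (L i)) = (\<Sum>u\<in>X. if f u = i then h u else 0)"
      unfolding herm_ip_def by (rule sum.cong) (auto simp: charvec_def L_def)
    also have "\<dots> = (\<Sum>u\<in>L i. h u)"
      unfolding L_def using fin by (simp add: sum.inter_filter)
    finally show ?thesis .
  qed
  have finG: "finite ?G" by simp
  \<comment> \<open>All empty levels share the zero function as generator, so a generator need not
    determine its level. At a point v of X, however, the only nonzero generator is that of the level
    of v.\<close>
  have supp: "g v = (if v \<in> X \<and> g = charvec (L (f v)) then 1 else 0)" if g: "g \<in> ?G" for g v
  proof -
    obtain i where i: "g = charvec (L i)" using g by (auto simp: L_def)
    show ?thesis
    proof (cases "v \<in> L i")
      case True
      then show ?thesis using i by (auto simp: L_def charvec_def)
    next
      case False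
      have "v \<in> X \<Longrightarrow> g \<noteq> charvec (L (f v))"
      proof
        assume "v \<in> X" "g = charvec (L (f v))"
        then have "g v = 1" by (simp add: charvec_def L_def)
        then show False using i False by (simp add: charvec_def)
      qed
      then show ?thesis using i False by (auto simp: charvec_def)
    qed
  qed
  have lincomb: "(\<Sum>g\<in>?G. c g * g v) = (if v \<in> X then c (charvec (L (f v))) else 0)" for c :: "_ \<Rightarrow> complex" and v
  proof (cases "v \<in> X")
    case True
    have "charvec (L (f v)) \<in> ?G" using f[OF True] by (auto simp: L_def)
    moreover have "(\<Sum>g\<in>?G. c g * g v) = (\<Sum>g\<in>?G. if g = charvec (L (f v)) then c g else 0)"
      using True by (intro sum.cong refl) (simp add: supp)
    ultimately show ?thesis using True finG by (simp add: sum.delta)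
  next
    case False
    have "(\<Sum>g\<in>?G. c g * g v) = (\<Sum>g\<in>?G. 0)"
      by (rule sum.cong[OF refl]) (simp add: supp False del: mem_Collect_eq)
    then show ?thesis using False by simp
  qed
  have Lpos: "card (L (f v)) \<noteq> 0" if "v \<in> X" for v
    using that fin by (auto simp: L_def card_eq_0_iff)
  have span: "?p \<in> fspan ?G"
  proof -
    \<comment> \<open>Coefficients in \<open>fspan\<close> are indexed by generators, not by levels,
      so the average is taken over the set where g equals 1.\<close>
    define c :: "('a \<Rightarrow> complex) \<Rightarrow> complex" where
      "c g = (\<Sum>u\<in>{u\<in>X. g u = 1}. w u) / of_nat (card {u\<in>X. g u = 1})" for g
    have "{u\<in>X. charvec (L (f v)) u = (1::complex)} = {u\<in>X. f u = f v}" for v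
      by (auto simp: charvec_def L_def)
    then have "?p = (\<lambda>v. \<Sum>g\<in>?G. c g * g v)"
      unfolding lincomb by (auto simp: c_def)
    then show ?thesis by (auto simp: fspan_def)
  qed
  have orth: "\<forall>g\<in>?G. herm_ip X (\<lambda>v. w v - ?p v) g = 0"
  proof
    fix g assume "g \<in> ?G"
    then obtain i where i: "g = charvec (L i)" by (auto simp: L_def)
    have "(\<Sum>u\<in>L i. ?p u) = (\<Sum>u\<in>L i. (\<Sum>u\<in>L i. w u) / of_nat (card (L i)))"
      by (rule sum.cong) (auto simp: L_def)
    also have "\<dots> = (\<Sum>u\<in>L i. w u)"
    proof (cases "L i = {}")
      case False
      moreover have "finite (L i)" using fin by (simp add: L_def)
      ultimately show ?thesis by simp
    qed simp
    finally show "herm_ip X (\<lambda>v. w v - ?p v) g = 0"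
      unfolding i ip by (simp add: sum_subtractf)
  qed
  show ?thesis unfolding orth_proj_def
  proof (rule the_equality)
    show "?p \<in> fspan ?G \<and> (\<forall>g\<in>?G. herm_ip X (\<lambda>v. w v - ?p v) g = 0)"
      using span orth by blast
  next
    fix p assume p: "p \<in> fspan ?G \<and> (\<forall>g\<in>?G. herm_ip X (\<lambda>v. w v - p v) g = 0)"
    then obtain c where c: "p = (\<lambda>v. \<Sum>g\<in>?G. c g * g v)" by (auto simp: fspan_def)
    show "p = ?p"
    proof
      fix v
      show "p v = ?p v"
      proof (cases "v \<in> X")
        case True
        have "charvec (L (f v)) \<in> ?G" using f[OF True] by (auto simp: L_def)
        then have "herm_ip X (\<lambda>u. w u - p u) (charvec (L (f v))) = 0" using p by blast
        then have "(\<Sum>u\<in>L (f v). w u) = (\<Sum>u\<in>L (f v). p u)"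
          unfolding ip by (simp add: sum_subtractf)
        also have "\<dots> = (\<Sum>u\<in>L (f v). p v)"
          unfolding c lincomb by (rule sum.cong) (use True in \<open>auto simp: L_def\<close>)
        finally have "(\<Sum>u\<in>L (f v). w u) = of_nat (card (L (f v))) * p v" by simp
        then show ?thesis using True Lpos[OF True] by (simp add: L_def)
      next
        case False
        then show ?thesis unfolding c lincomb by simp
      qed
    qed
  qed
qed

lemma sum_by_position:
  fixes c :: "nat \<Rightarrow> 'b::semiring_1"
  assumes "finite X" "\<And>v. v \<in> X \<Longrightarrow> pos v < N"
  shows "(\<Sum>u\<in>{u\<in>X. P (pos u)}. c (pos u))
    = (\<Sum>t<N. if P t then of_nat (card {u\<in>X. pos u = t}) * c t else 0)"
proof -
  have "(\<Sum>u\<in>{u\<in>X. P (pos u)}. c (pos u))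
      = (\<Sum>t<N. \<Sum>u\<in>{u\<in>{u\<in>X. P (pos u)}. pos u = t}. c (pos u))"
    by (rule sum.group[symmetric]) (use assms in auto)
  also have "\<dots> = (\<Sum>t<N. if P t then of_nat (card {u\<in>X. pos u = t}) * c t else 0)"
  proof (rule sum.cong[OF refl])
    fix t
    have "{u\<in>{u\<in>X. P (pos u)}. pos u = t} = (if P t then {u\<in>X. pos u = t} else {})" by auto
    moreover have "(\<Sum>u\<in>{u\<in>X. pos u = t}. c (pos u)) = (\<Sum>u\<in>{u\<in>X. pos u = t}. c t)"
      by (rule sum.cong) auto
    ultimately show "(\<Sum>u\<in>{u\<in>{u\<in>X. P (pos u)}. pos u = t}. c (pos u))
        = (if P t then of_nat (card {u\<in>X. pos u = t}) * c t else 0)" by simp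
  qed
  finally show ?thesis .
qed

text \<open>Averaging over a block gives each coordinate t of that block the weight of its cell
  divided by the size of the block. The hypothesis on P states this in multiplied form, so that it
  also makes sense for positions whose block is empty.\<close>

lemma orth_proj_blocks:
  fixes pos :: "'a \<Rightarrow> nat" and blk :: "nat \<Rightarrow> nat" and c :: "nat \<Rightarrow> complex"
  assumes fin: "finite X" and pos: "\<And>v. v \<in> X \<Longrightarrow> pos v < N"
    and blk: "\<And>v. v \<in> X \<Longrightarrow> blk (pos v) \<le> m"
    and P: "\<And>r t. r < N \<Longrightarrow> t < N \<Longrightarrow>
      P r t * (\<Sum>u<N. if blk u = blk r then of_nat (card {v\<in>X. pos v = u}) else 0)
        = (if blk t = blk r then of_nat (card {v\<in>X. pos v = t}) else 0)"
  shows "orth_proj X {charvec {v\<in>X. blk (pos v) = i} | i. i \<le> m} (\<lambda>v. if v \<in> X then c (pos v) else 0)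
    = (\<lambda>v. if v \<in> X then \<Sum>t<N. P (pos v) t * c t else 0)"
proof -
  let ?n = "\<lambda>t. of_nat (card {v\<in>X. pos v = t}) :: complex"
  have "(\<Sum>u\<in>{u\<in>X. blk (pos u) = blk (pos v)}. if u \<in> X then c (pos u) else 0)
      / of_nat (card {u\<in>X. blk (pos u) = blk (pos v)}) = (\<Sum>t<N. P (pos v) t * c t)" if v: "v \<in> X" for v
  proof -
    let ?b = "blk (pos v)"
    define T where "T = (\<Sum>u<N. if blk u = ?b then ?n u else 0)"
    have num: "(\<Sum>u\<in>{u\<in>X. blk (pos u) = ?b}. if u \<in> X then c (pos u) else 0)
        = (\<Sum>t<N. if blk t = ?b then ?n t * c t else 0)"
      using sum_by_position[where pos = pos, OF fin pos, where P = "\<lambda>t. blk t = ?b" and c = c] by simp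
    have den: "of_nat (card {u\<in>X. blk (pos u) = ?b}) = T"
      using sum_by_position[where pos = pos, OF fin pos, where P = "\<lambda>t. blk t = ?b" and c = "\<lambda>_. 1::complex"]
      by (simp only: T_def mult_1_right sum_constant)
    have "card {u\<in>X. blk (pos u) = ?b} \<noteq> 0" using v fin by (auto simp: card_eq_0_iff)
    then have T0: "T \<noteq> 0" unfolding den[symmetric] by simp
    have "(\<Sum>t<N. P (pos v) t * c t) * T = (\<Sum>t<N. (P (pos v) t * T) * c t)"
      unfolding sum_distrib_right by (simp only: mult_ac)
    also have "\<dots> = (\<Sum>t<N. if blk t = ?b then ?n t * c t else 0)"
    proof (rule sum.cong[OF refl])
      fix t assume "t \<in> {..<N}"
      then have "P (pos v) t * T = (if blk t = ?b then ?n t else 0)"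
        unfolding T_def by (intro P pos[OF v]) simp
      then show "(P (pos v) t * T) * c t = (if blk t = ?b then ?n t * c t else 0)" by simp
    qed
    finally show ?thesis unfolding num den using T0 by (simp add: field_simps)
  qed
  then have "(\<lambda>v. if v \<in> X then (\<Sum>u\<in>{u\<in>X. blk (pos u) = blk (pos v)}. if u \<in> X then c (pos u) else 0)
      / of_nat (card {u\<in>X. blk (pos u) = blk (pos v)}) else 0) = (\<lambda>v. if v \<in> X then \<Sum>t<N. P (pos v) t * c t else 0)"
    by (intro ext if_cong refl)
  with orth_proj_levels[where f = "\<lambda>v. blk (pos v)" and w = "\<lambda>v. if v \<in> X then c (pos v) else 0", OF fin blk]
  show ?thesis by (rule trans)
qed

text \<open>With \<open>k = q powr (e / 2)\<close>, adding \<open>inverse \<kappa> = k\<close> to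
  the diagonal makes both rows of a block equal to (1/k, k). Dividing by 1/k + k gives the weights
  1/(1 + k^2) and k^2/(1 + k^2), and the cell sizes are in the ratio 1 to k^2.\<close>

lemma Tmat_block_average:
  fixes q e :: real and n :: "nat \<Rightarrow> nat"
  assumes q: "q > 0" and n: "\<And>i. i < D \<Longrightarrow> real (n (2 * i + 1)) = q powr e * real (n (2 * i))"
    and r: "r < 2 * D" and t: "t < 2 * D"
  defines "\<kappa> \<equiv> complex_of_real (q powr (- e / 2))"
  shows "(Tmat q e r t + (if r = t then inverse \<kappa> else 0)) / (\<kappa> + inverse \<kappa>)
      * (\<Sum>u<2*D. if u div 2 = r div 2 then of_nat (n u) else 0)
    = (if t div 2 = r div 2 then of_nat (n t) else 0)"
proof -
  define k where "k = q powr (e / 2)"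
  have k: "k > 0" "q powr e = k * k" "q powr (- e / 2) = inverse k"
    using q by (auto simp: k_def powr_minus simp flip: powr_add)
  have \<kappa>: "\<kappa> = complex_of_real (inverse k)" unfolding \<kappa>_def k(3) ..
  have den: "\<kappa> + inverse \<kappa> = complex_of_real (inverse k + k)" by (simp add: \<kappa>)
  define i where "i = r div 2"
  have i: "i < D" using r by (auto simp: i_def)
  have S: "(\<Sum>u<2*D. if u div 2 = i then of_nat (n u) else (0::complex)) = of_real (real (n (2 * i)) * (1 + k * k))"
  proof -
    have "(\<Sum>u<2*D. if u div 2 = i then of_nat (n u) else (0::complex)) = (\<Sum>u\<in>{2 * i, 2 * i + 1}. of_nat (n u))"
      by (rule sum.mono_neutral_cong_right) (use i in auto)
    also have "\<dots> = of_real (real (n (2 * i)) + real (n (2 * i + 1)))" by simp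
    also have "real (n (2 * i)) + real (n (2 * i + 1)) = real (n (2 * i)) * (1 + k * k)"
      unfolding n[OF i] k(2) by (simp add: algebra_simps)
    finally show ?thesis .
  qed
  have E: "Tmat q e r t + (if r = t then inverse \<kappa> else 0)
      = (if t div 2 = i then of_real (if even t then inverse k else k) else 0)"
  proof -
    have rt: "r = t \<longleftrightarrow> r div 2 = t div 2 \<and> (even r \<longleftrightarrow> even t)" by presburger
    show ?thesis
      unfolding Tmat_def i_def rt k(3) k_def[symmetric] \<kappa>
      by (cases "r div 2 = t div 2"; cases "even r"; cases "even t") simp_all
  qed
  show ?thesis
  proof (cases "t div 2 = i")
    case False
    then show ?thesis unfolding E by (simp add: i_def)
  next
    case True
    then have "n t = (if even t then n (2 * i) else n (2 * i + 1))" by auto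
    then have nt: "real (n t) = (if even t then 1 else k * k) * real (n (2 * i))"
      using n[OF i] by (simp add: k(2))
    have "(if even t then inverse k else k) / (inverse k + k) * (real (n (2 * i)) * (1 + k * k)) = real (n t)"
    proof -
      have "inverse k + k = (1 + k * k) / k" using k(1) by (simp add: field_simps)
      moreover have "1 + k * k \<noteq> 0" using k(1) by (metis add_pos_pos mult_pos_pos zero_less_one less_irrefl)
      ultimately show ?thesis using k(1) unfolding nt by simp
    qed
    then have "complex_of_real ((if even t then inverse k else k) / (inverse k + k) * (real (n (2 * i)) * (1 + k * k)))
        = of_nat (n t)" by (simp only: of_real_of_nat_eq)
    then show ?thesis
      using True unfolding E den i_def[symmetric] S
      by (simp only: if_True of_real_divide of_real_mult refl)
  qed
qed

text \<open>With \<open>a = q powr (- D / 2)\<close> one has \<open>1 / a = a * q ^ D\<close>, so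
  the inverse of \<open>\<kappa>'\<close> is \<open>- \<i> * a * q ^ D\<close>. Adding it to the
  diagonal makes both rows of an inner block equal to \<open>\<i> * a\<close> times (1 - q^i, q^i -
  q^D), and the denominator is \<open>\<i> * a * (1 - q ^ D)\<close>. These quotients are the
  relative sizes of \<open>C_(i-1)^+\<close> and \<open>C_i^-\<close>.\<close>

lemma T'mat_block_average:
  fixes q :: real and n :: "nat \<Rightarrow> nat"
  assumes q: "q > 1" and D: "D > 0"
    and n: "\<And>i. 1 \<le> i \<Longrightarrow> i < D \<Longrightarrow> real (n (2 * i - 1)) * (q ^ D - q ^ i) = real (n (2 * i)) * (q ^ i - 1)"
    and r: "r < 2 * D" and t: "t < 2 * D"
  defines "\<kappa>' \<equiv> \<i> * complex_of_real (q powr (- real D / 2))"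
  shows "(T'mat q D r t + (if r = t then inverse \<kappa>' else 0)) / (\<kappa>' + inverse \<kappa>')
      * (\<Sum>u<2*D. if (u + 1) div 2 = (r + 1) div 2 then of_nat (n u) else 0)
    = (if (t + 1) div 2 = (r + 1) div 2 then of_nat (n t) else 0)"
proof -
  define a where "a = q powr (- real D / 2)"
  have a: "a > 0" using q by (simp add: a_def)
  have a_inv: "inverse a = a * q ^ D"
  proof -
    have "a * a * q powr (real D) = 1"
      using q unfolding a_def by (simp flip: powr_add)
    then have "a * (a * q ^ D) = 1" using q by (simp add: powr_realpow mult_ac)
    then show ?thesis by (rule inverse_unique)
  qed
  have p1: "q powr (real D / 2) = a * q ^ D"
    using a_inv unfolding a_def by (simp add: powr_minus)
  have p2: "q powr (real j - real D) = q ^ j / q ^ D" for j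
    using q by (simp add: powr_diff powr_realpow)
  have p3: "q powr (real j - real D / 2) = a * q ^ j" for j
  proof -
    have "q powr (real j - real D / 2) = q powr (- real D / 2 + real j)" by simp
    also have "\<dots> = a * q ^ j" using q unfolding a_def by (simp only: powr_add powr_realpow)
    finally show ?thesis .
  qed
  have qD: "q ^ D > 1" using q D by simp
  have \<kappa>': "\<kappa>' = \<i> * complex_of_real a" by (simp add: \<kappa>'_def a_def)
  have \<kappa>'_inv: "inverse \<kappa>' = - (\<i> * complex_of_real (a * q ^ D))"
    unfolding \<kappa>' a_inv[symmetric] by (simp add: mult.commute)
  have den: "\<kappa>' + inverse \<kappa>' = \<i> * complex_of_real (a * (1 - q ^ D))"
    unfolding \<kappa>'_inv unfolding \<kappa>' by (simp add: algebra_simps)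
  have "a * (1 - q ^ D) \<noteq> 0" using a qD by simp
  then have den0: "\<kappa>' + inverse \<kappa>' \<noteq> 0" unfolding den by (simp only: mult_eq_0_iff of_real_eq_0_iff) simp
  define i where "i = (r + 1) div 2"
  have iD: "i \<le> D" using r by (auto simp: i_def)
  let ?S = "\<Sum>u<2*D. if (u + 1) div 2 = i then of_nat (n u) else (0::complex)"
  show ?thesis
  proof (cases "(t + 1) div 2 = i")
    case False
    then have "T'mat q D r t + (if r = t then inverse \<kappa>' else 0) = 0"
      by (auto simp: T'mat_def i_def Let_def)
    then show ?thesis using False by (simp add: i_def)
  next
    case ti: True
    show ?thesis
    proof (cases "i = 0 \<or> i = D")
      case True
      \<comment> \<open>The two end blocks consist of a single position; for i = 0 the truncated
        difference \<open>2 * i - 1\<close> is the intended position 0.\<close>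
      have uniq: "u = 2 * i - 1" if u: "u < 2 * D" "(u + 1) div 2 = i" for u
      proof (cases "i = 0")
        case True
        then show ?thesis using u(2) by simp
      next
        case False
        then have "i = D" using \<open>i = 0 \<or> i = D\<close> by blast
        then show ?thesis using u by linarith
      qed
      have rt: "r = t" using uniq[OF r] uniq[OF t ti] by (simp add: i_def)
      have "?S = (\<Sum>u\<in>{t}. of_nat (n u))"
      proof (rule sum.mono_neutral_cong_right)
        show "\<forall>u\<in>{..<2 * D} - {t}. (if (u + 1) div 2 = i then of_nat (n u) else (0::complex)) = 0"
        proof
          fix u assume "u \<in> {..<2 * D} - {t}"
          then have "(u + 1) div 2 \<noteq> i" using uniq[of u] uniq[OF t ti] by auto
          then show "(if (u + 1) div 2 = i then of_nat (n u) else (0::complex)) = 0" by simp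
        qed
      qed (use t ti in auto)
      moreover have "T'mat q D r t + (if r = t then inverse \<kappa>' else 0) = \<kappa>' + inverse \<kappa>'"
        using True rt by (auto simp: T'mat_def i_def Let_def \<kappa>'_def)
      ultimately show ?thesis using ti den0 unfolding i_def[symmetric] by simp
    next
      case False
      then have i: "1 \<le> i" "i < D" using iD by auto
      have S: "?S = of_real (real (n (2 * i - 1)) + real (n (2 * i)))"
      proof -
        have "?S = (\<Sum>u\<in>{2 * i - 1, 2 * i}. of_nat (n u))"
          by (rule sum.mono_neutral_cong_right) (use i in auto)
        then show ?thesis using i by simp
      qed
      have E: "T'mat q D r t + (if r = t then inverse \<kappa>' else 0)
          = \<i> * complex_of_real (a * (if odd t then 1 - q ^ i else q ^ i - q ^ D))"
      proof -
        have rt: "r = t \<longleftrightarrow> (even r \<longleftrightarrow> even t)" using ti unfolding i_def by presburger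
        have "a * q ^ D * (q ^ i / q ^ D - 1) = a * (q ^ i - q ^ D)"
          using q by (simp add: field_simps)
        then show ?thesis
          using False ti unfolding T'mat_def i_def[symmetric] Let_def rt \<kappa>'_inv a_def[symmetric] p1 p2 p3
          by (cases "even r"; cases "even t") (simp_all add: algebra_simps)
      qed
      have "n t = (if odd t then n (2 * i - 1) else n (2 * i))" using ti by auto
      then have nt: "real (n t) * (1 - q ^ D)
          = (if odd t then 1 - q ^ i else q ^ i - q ^ D) * (real (n (2 * i - 1)) + real (n (2 * i)))"
        using n[OF i] by (simp add: algebra_simps)
      have "(T'mat q D r t + (if r = t then inverse \<kappa>' else 0)) * ?S
          = \<i> * complex_of_real (a * ((if odd t then 1 - q ^ i else q ^ i - q ^ D)
              * (real (n (2 * i - 1)) + real (n (2 * i)))))"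
        unfolding E S by (simp only: of_real_mult mult_ac)
      also have "\<dots> = (\<kappa>' + inverse \<kappa>') * of_nat (n t)"
        unfolding nt[symmetric] den by (simp only: of_real_mult of_real_of_nat_eq mult_ac)
      finally show ?thesis using ti den0 unfolding i_def[symmetric] by (simp add: divide_eq_eq mult.commute)
    qed
  qed
qed

section \<open>The two projections in the basis of cells\<close>

context polar_clique
begin

lemma sum_basis_vec:
  "(\<Sum>r<2 * D. a r * basis_vec R X x C r v) = (if v \<in> X then a (pos v) else 0)"
proof (cases "v \<in> X")
  case True
  have "(\<Sum>r<2 * D. a r * basis_vec R X x C r v) = (\<Sum>r<2 * D. if r = pos v then a r else 0)"
    by (rule sum.cong) (auto simp: basis_vec_pos True)
  then show ?thesis using pos_less[OF True] True by (simp add: sum.delta)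
qed (simp add: basis_vec_pos)

lemma orth_proj_set_dist:
  assumes M_e: "M = q powr e"
  defines "\<kappa> \<equiv> complex_of_real (q powr (- e / 2))"
  shows "orth_proj X {charvec {v\<in>X. set_dist R C v = i} | i. i \<le> D - 1}
      (\<lambda>v. \<Sum>j<2*D. c j * basis_vec R X x C j v)
    = (\<lambda>v. \<Sum>r<2*D. ((\<Sum>s<2*D. (Tmat q e r s + (if r = s then inverse \<kappa> else 0)) * c s)
          / (\<kappa> + inverse \<kappa>)) * basis_vec R X x C r v)"
proof -
  have "orth_proj X {charvec {v\<in>X. pos v div 2 = i} | i. i \<le> D - 1} (\<lambda>v. if v \<in> X then c (pos v) else 0)
    = (\<lambda>v. if v \<in> X then \<Sum>t<2*D. (Tmat q e (pos v) t + (if pos v = t then inverse \<kappa> else 0)) / (\<kappa> + inverse \<kappa>) * c t else 0)"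
  proof (rule orth_proj_blocks[where blk = "\<lambda>r. r div 2"])
    show "pos v div 2 \<le> D - 1" if "v \<in> X" for v using pos_less[OF that] by simp
    show "(Tmat q e r t + (if r = t then inverse \<kappa> else 0)) / (\<kappa> + inverse \<kappa>)
          * (\<Sum>u<2*D. if u div 2 = r div 2 then of_nat (card {v\<in>X. pos v = u}) else 0)
        = (if t div 2 = r div 2 then of_nat (card {v\<in>X. pos v = t}) else 0)"
      if "r < 2 * D" "t < 2 * D" for r t
      unfolding \<kappa>_def cnt_def[symmetric]
    proof (rule Tmat_block_average[OF _ _ that])
      show "q > 0" using q_ge2 by simp
      show "real (cnt (2 * i + 1)) = q powr e * real (cnt (2 * i))" if "i < D" for i
        using cnt_set_dist_block[OF that] unfolding M_e .
    qed
  qed (rule finite, rule pos_less)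
  then show ?thesis
    by (simp only: sum_basis_vec pos_div_2 sum_divide_distrib times_divide_eq_left)
qed

lemma orth_proj_gdist:
  defines "\<kappa>' \<equiv> \<i> * complex_of_real (q powr (- real D / 2))"
  shows "orth_proj X {charvec (Gam R X x i) | i. i \<le> D}
      (\<lambda>v. \<Sum>j<2*D. c j * basis_vec R X x C j v)
    = (\<lambda>v. \<Sum>r<2*D. ((\<Sum>s<2*D. (T'mat q D r s + (if r = s then inverse \<kappa>' else 0)) * c s)
          / (\<kappa>' + inverse \<kappa>')) * basis_vec R X x C r v)"
proof -
  have Gam: "Gam R X x i = {v\<in>X. (pos v + 1) div 2 = i}" for i
    unfolding Gam_def by (rule Collect_cong, rule conj_cong[OF refl]) (simp only: pos_Suc_div_2)
  have "orth_proj X {charvec {v\<in>X. (pos v + 1) div 2 = i} | i. i \<le> D} (\<lambda>v. if v \<in> X then c (pos v) else 0)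
    = (\<lambda>v. if v \<in> X then \<Sum>t<2*D. (T'mat q D (pos v) t + (if pos v = t then inverse \<kappa>' else 0)) / (\<kappa>' + inverse \<kappa>') * c t else 0)"
  proof (rule orth_proj_blocks[where blk = "\<lambda>r. (r + 1) div 2"])
    show "(pos v + 1) div 2 \<le> D" if "v \<in> X" for v using pos_less[OF that] by simp
    show "(T'mat q D r t + (if r = t then inverse \<kappa>' else 0)) / (\<kappa>' + inverse \<kappa>')
          * (\<Sum>u<2*D. if (u + 1) div 2 = (r + 1) div 2 then of_nat (card {v\<in>X. pos v = u}) else 0)
        = (if (t + 1) div 2 = (r + 1) div 2 then of_nat (card {v\<in>X. pos v = t}) else 0)"
      if "r < 2 * D" "t < 2 * D" for r t
      unfolding \<kappa>'_def cnt_def[symmetric]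
    proof (rule T'mat_block_average[OF _ _ _ that])
      show "q > 1" using q_ge2 by simp
      show "D > 0" using D_pos by simp
    qed (rule cnt_gdist_block)
  qed (rule finite, rule pos_less)
  then show ?thesis
    by (simp only: Gam sum_basis_vec sum_divide_distrib times_divide_eq_left)
qed

end

lemma (in polar) projections_maximal_clique:
  assumes "M = q powr e" "x \<in> C" "is_maximal_clique R X C"
  defines "\<kappa> \<equiv> complex_of_real (q powr (- e / 2))"
    and "\<kappa>' \<equiv> \<i> * complex_of_real (q powr (- real D / 2))"
  shows "orth_proj X {charvec (Gam R X x i) | i. i \<le> D}
      (\<lambda>v. \<Sum>j<2*D. c j * basis_vec R X x C j v)
    = (\<lambda>v. \<Sum>r<2*D. ((\<Sum>s<2*D. (T'mat q D r s + (if r = s then inverse \<kappa>' else 0)) * c s)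
          / (\<kappa>' + inverse \<kappa>')) * basis_vec R X x C r v)"
    and "orth_proj X {charvec {v\<in>X. set_dist R C v = i} | i. i \<le> D - 1}
      (\<lambda>v. \<Sum>j<2*D. c j * basis_vec R X x C j v)
    = (\<lambda>v. \<Sum>r<2*D. ((\<Sum>s<2*D. (Tmat q e r s + (if r = s then inverse \<kappa> else 0)) * c s)
          / (\<kappa> + inverse \<kappa>)) * basis_vec R X x C r v)"
proof -
  obtain E where E: "vec.subspace E" "E \<subseteq> x" "vec.dim E = D - 1" "C = {v\<in>X. E \<subseteq> v}"
    using maximal_clique_eq[OF assms(3,2)] by blast
  have xX: "x \<in> X" using assms(2) unfolding E(4) by blast
  have clique: "polar_clique B iso s TI D q M x E"
    by (rule polar_clique.intro[OF polar_axioms polar_clique_axioms.intro[OF xX E(1-3)]])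
  show "orth_proj X {charvec (Gam R X x i) | i. i \<le> D}
      (\<lambda>v. \<Sum>j<2*D. c j * basis_vec R X x C j v)
    = (\<lambda>v. \<Sum>r<2*D. ((\<Sum>s<2*D. (T'mat q D r s + (if r = s then inverse \<kappa>' else 0)) * c s)
          / (\<kappa>' + inverse \<kappa>')) * basis_vec R X x C r v)"
    unfolding E(4) \<kappa>'_def by (rule polar_clique.orth_proj_gdist[OF clique])
  show "orth_proj X {charvec {v\<in>X. set_dist R C v = i} | i. i \<le> D - 1}
      (\<lambda>v. \<Sum>j<2*D. c j * basis_vec R X x C j v)
    = (\<lambda>v. \<Sum>r<2*D. ((\<Sum>s<2*D. (Tmat q e r s + (if r = s then inverse \<kappa> else 0)) * c s)
          / (\<kappa> + inverse \<kappa>)) * basis_vec R X x C r v)"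
    unfolding E(4) \<kappa>_def by (rule polar_clique.orth_proj_set_dist[OF clique assms(1)])
qed

section \<open>The three types of forms\<close>

text \<open>Every vector is isotropic, so all q points of a line count and s = q.\<close>

lemma polar_alternating:
  fixes f :: "'f::{field,finite}^'n \<Rightarrow> 'f^'n \<Rightarrow> 'f"
  assumes f: "alternating_form f" "nondegenerate f"
    and TI: "TI = {U. vec.subspace U \<and> (\<forall>u\<in>U. \<forall>w\<in>U. f u w = 0)}"
    and D: "D = Max (vec.dim ` TI)" "D \<ge> 1"
  shows "polar f (\<lambda>_. True) CARD('f) TI D (real CARD('f))
    (real CARD('f) * real CARD('f) ^ CARD('n) / real CARD('f) ^ (2 * D))"
proof
  have add: "f (u + v) w = f u w + f v w" "f u (v + w) = f u v + f u w"
    and scale: "f (c *s u) w = c * f u w" and alt: "f v v = 0" for u v w c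
    using f(1) by (auto simp: alternating_form_def bilinear_form_def)
  have skew: "f u w = - f w u" for u w
  proof -
    have "f u w + f w u = (f u u + f u w) + (f w u + f w w)" by (simp add: alt)
    also have "\<dots> = f (u + w) (u + w)" by (simp only: add add_ac)
    finally show ?thesis by (simp add: alt eq_neg_iff_add_eq_0)
  qed
  show "f u w = 0 \<longleftrightarrow> f w u = 0" for u w using skew[of u w] by simp
  show "u = 0" if "\<And>w. f u w = 0" for u using f(2) that by (auto simp: nondegenerate_def)
qed (use assms in \<open>auto simp: alternating_form_def bilinear_form_def\<close>)

text \<open>Along a line with singular direction z, \<open>Q (p + a *s z)\<close> is affine in a
  with slope \<open>polar_form Q p z\<close>; its single root gives s = 1.\<close>

lemma polar_quadratic:
  fixes Q :: "'f::{field,finite}^'n \<Rightarrow> 'f"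
  assumes Q: "quadratic_form Q" "nondegenerate_quadratic Q"
    and TI: "TI = {U. vec.subspace U \<and> (\<forall>u\<in>U. Q u = 0)}"
    and D: "D = Max (vec.dim ` TI)" "D \<ge> 1"
  shows "polar (polar_form Q) (\<lambda>v. Q v = 0) 1 TI D (real CARD('f))
    (real CARD('f) ^ CARD('n) / real CARD('f) ^ (2 * D))"
proof
  have scale: "polar_form Q (c *s u) w = c * polar_form Q u w" "polar_form Q u (c *s w) = c * polar_form Q u w"
    and Qs: "Q (c *s v) = c^2 * Q v" for u v w c
    using Q(1) by (auto simp: quadratic_form_def bilinear_form_def)
  have Qadd: "Q (u + w) = Q u + Q w + polar_form Q u w" for u w
    by (simp add: polar_form_def)
  show "polar_form Q u w = 0 \<longleftrightarrow> polar_form Q w u = 0" for u w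
    unfolding polar_form_def by (simp only: add.commute[of u w] diff_diff_eq add.commute[of "Q u" "Q w"])
  show "polar_form Q (u + v) w = polar_form Q u w + polar_form Q v w"
    "polar_form Q (c *s u) w = c * polar_form Q u w" for u v w c
    using Q(1) by (auto simp: quadratic_form_def bilinear_form_def)
  show "Q 0 = 0" using Qs[of 0 0] by simp
  show "Q (c *s u) = 0" if "Q u = 0" for c u using that by (simp add: Qs)
  show "Q (u + v) = 0" if "Q u = 0" "Q v = 0" "polar_form Q u v = 0" for u v
    using that by (simp add: Qadd)
  \<comment> \<open>Evaluating Q at u + u as a scalar multiple of u works in every
    characteristic.\<close>
  show "polar_form Q u u = 0" if "Q u = 0" for u
  proof -
    have "u + u = (1 + 1) *s u" by (simp only: vec.scale_left_distrib vec.scale_one)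
    then have "Q (u + u) = (1 + 1)^2 * Q u" by (simp only: Qs)
    then show ?thesis using that by (simp add: polar_form_def)
  qed
  show "u = 0" if "Q u = 0" "\<And>w. polar_form Q u w = 0" for u
    using Q(2) that by (auto simp: nondegenerate_quadratic_def)
  show "card {a. Q (p + a *s z) = 0} = 1" if z: "Q z = 0" "polar_form Q p z \<noteq> 0" for p z
  proof -
    have "Q (p + a *s z) = Q p + a * polar_form Q p z" for a by (simp add: Qadd Qs scale z)
    then have "{a. Q (p + a *s z) = 0} = {- Q p / polar_form Q p z}"
      using z(2) by (auto simp: field_simps add_eq_0_iff2)
    then show ?thesis by simp
  qed
  show "TI = {U. vec.subspace U \<and> (\<forall>u\<in>U. Q u = 0) \<and> (\<forall>u\<in>U. \<forall>w\<in>U. polar_form Q u w = 0)}"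
    unfolding TI by (rule Collect_cong) (auto simp: polar_form_def vec.subspace_add)
qed (use D in auto)

text \<open>The trace \<open>y + \<sigma> y\<close> maps onto the fixed field with fibres that are
  translates of its kernel, and the kernel has as many elements as the fixed field. Hence s is the
  size of the fixed field, and summing over the fibres gives \<open>s * s\<close>.\<close>

lemma field_involution_trace_fibres:
  fixes \<sigma> :: "'f::{field,finite} \<Rightarrow> 'f"
  assumes "field_involution \<sigma>"
  obtains s where "s * s = CARD('f)" "\<And>c. \<sigma> c = c \<Longrightarrow> card {y. y + \<sigma> y = c} = s"
proof -
  have add: "\<sigma> (a + b) = \<sigma> a + \<sigma> b" and mult: "\<sigma> (a * b) = \<sigma> a * \<sigma> b" and inv: "\<sigma> (\<sigma> a) = a" for a b
    using assms by (auto simp: field_involution_def)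
  obtain a where a: "\<sigma> a \<noteq> a" using assms by (auto simp: field_involution_def)
  have "\<sigma> 0 + 0 = \<sigma> 0 + \<sigma> 0" using add[of 0 0] by (simp only: add_0_right)
  then have s0: "\<sigma> 0 = 0" by (simp only: add_left_cancel)
  have nz: "\<sigma> y = 0 \<longleftrightarrow> y = 0" for y using inv[of y] s0 by auto
  have s1: "\<sigma> 1 = 1" using mult[of 1 1] nz[of 1] by simp
  have neg: "\<sigma> (- y) = - \<sigma> y" for y using add[of y "- y"] s0 by (simp add: eq_neg_iff_add_eq_0 add.commute)
  have diff: "\<sigma> (y - z) = \<sigma> y - \<sigma> z" for y z using add[of y "- z"] neg[of z] by simp
  have div: "\<sigma> (y / z) = \<sigma> y / \<sigma> z" if "z \<noteq> 0" for y z
    using mult[of "y / z" z] that nz[of z] by (simp add: field_simps)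
  define Fix where "Fix = {c. \<sigma> c = c}"
  define Ker where "Ker = {y. y + \<sigma> y = 0}"
  \<comment> \<open>\<open>\<sigma>\<close> negates d, so multiplication by d carries fixed elements
    to elements of trace zero; this needs no case split on the characteristic.\<close>
  define d where "d = a - \<sigma> a"
  have d: "d \<noteq> 0" "\<sigma> d = - d" using a by (auto simp: d_def diff inv)
  have "bij_betw (\<lambda>c. d * c) Fix Ker"
  proof (rule bij_betwI[where g = "\<lambda>y. y / d"])
    show "(\<lambda>c. d * c) \<in> Fix \<rightarrow> Ker" by (auto simp: Fix_def Ker_def mult d)
    show "(\<lambda>y. y / d) \<in> Ker \<rightarrow> Fix"
    proof
      fix y assume "y \<in> Ker"
      then have "\<sigma> y = - y" by (simp add: Ker_def eq_neg_iff_add_eq_0 add.commute)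
      then show "y / d \<in> Fix" using d by (simp add: Fix_def div)
    qed
  qed (use d in auto)
  from bij_betw_same_card[OF this] have KF: "card Ker = card Fix" by (rule sym)
  \<comment> \<open>If the trace were zero throughout, its value at 1 would give 1 + 1 = 0, so a + a
    = 0 = a + \<open>\<sigma> a\<close>, and a would be fixed.\<close>
  have "\<exists>y0. y0 + \<sigma> y0 \<noteq> 0"
  proof (rule ccontr)
    assume "\<not> (\<exists>y0. y0 + \<sigma> y0 \<noteq> 0)"
    then have all: "y + \<sigma> y = 0" for y by blast
    have "(1::'f) + 1 = 0" using all[of 1] s1 by simp
    then have "a * (1 + 1) = 0" by (simp only: mult_zero_right)
    then have "a + a = a + \<sigma> a" by (simp only: all distrib_left mult_1_right)
    then show False using a by simp
  qed
  then obtain y0 where y0: "y0 + \<sigma> y0 \<noteq> 0" by blast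
  have fibre: "card {y. y + \<sigma> y = c} = card Fix" if c: "\<sigma> c = c" for c
  proof -
    \<comment> \<open>r is fixed by \<open>\<sigma>\<close>, so scaling y0 by r scales its trace by
      r, here to c. The fibre over c is then the kernel translated by \<open>r * y0\<close>.\<close>
    define r where "r = c / (y0 + \<sigma> y0)"
    have "\<sigma> r = r" using y0 c by (simp add: r_def div add inv add.commute)
    then have "r * y0 + \<sigma> (r * y0) = r * (y0 + \<sigma> y0)" by (simp add: mult distrib_left)
    also have "\<dots> = c" using y0 by (simp add: r_def)
    finally have r: "r * y0 + \<sigma> (r * y0) = c" .
    have "bij_betw (\<lambda>k. k + r * y0) Ker {y. y + \<sigma> y = c}"
    proof (rule bij_betwI[where g = "\<lambda>y. y - r * y0"])
      have "k + r * y0 + \<sigma> (k + r * y0) = (k + \<sigma> k) + c" for k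
        unfolding r[symmetric] by (simp only: add add_ac)
      then show "(\<lambda>k. k + r * y0) \<in> Ker \<rightarrow> {y. y + \<sigma> y = c}"
        by (intro Pi_I) (simp only: Ker_def mem_Collect_eq add_0)
      have "y - r * y0 + \<sigma> (y - r * y0) = (y + \<sigma> y) - c" for y
        unfolding r[symmetric] by (simp add: diff)
      then show "(\<lambda>y. y - r * y0) \<in> {y. y + \<sigma> y = c} \<rightarrow> Ker"
        by (intro Pi_I) (simp only: Ker_def mem_Collect_eq diff_self)
    qed auto
    from bij_betw_same_card[OF this] show ?thesis using KF by simp
  qed
  have "CARD('f) = (\<Sum>c\<in>Fix. card {y\<in>UNIV. y + \<sigma> y = c})"
  proof -
    have "(\<Sum>c\<in>Fix. card {y\<in>UNIV. y + \<sigma> y = c}) = (\<Sum>y\<in>UNIV. card {c\<in>Fix. y + \<sigma> y = c})"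
      by (rule double_count[symmetric]) auto
    moreover have "{c\<in>Fix. y + \<sigma> y = c} = {y + \<sigma> y}" for y
      by (auto simp: Fix_def add inv add.commute)
    ultimately show ?thesis by simp
  qed
  also have "\<dots> = card Fix * card Fix" using fibre by (simp add: Fix_def)
  finally show ?thesis using that[of "card Fix"] fibre by simp
qed

text \<open>For isotropic z the value of the form at \<open>p + a *s z\<close> is
  \<open>h p p\<close> plus the trace of \<open>a * h z p\<close>. Isotropic points of the line thus
  correspond to elements of trace \<open>- h p p\<close>, a fixed element, so s is the square root
  of q.\<close>

lemma polar_hermitian:
  fixes h :: "'f::{field,finite}^'n \<Rightarrow> 'f^'n \<Rightarrow> 'f"
  assumes h: "hermitian_form \<sigma> h" "nondegenerate h"
    and TI: "TI = {U. vec.subspace U \<and> (\<forall>u\<in>U. \<forall>w\<in>U. h u w = 0)}"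
    and D: "D = Max (vec.dim ` TI)" "D \<ge> 1"
  obtains s where "s * s = CARD('f)" "polar h (\<lambda>v. h v v = 0) s TI D (real CARD('f))
    (real s * real CARD('f) ^ CARD('n) / real CARD('f) ^ (2 * D))"
proof -
  have \<sigma>: "field_involution \<sigma>" using h(1) by (simp add: hermitian_form_def)
  have \<sigma>add: "\<sigma> (a + b) = \<sigma> a + \<sigma> b" and \<sigma>mult: "\<sigma> (a * b) = \<sigma> a * \<sigma> b" and \<sigma>inv: "\<sigma> (\<sigma> a) = a" for a b
    using \<sigma> by (auto simp: field_involution_def)
  have "\<sigma> 0 + 0 = \<sigma> 0 + \<sigma> 0" using \<sigma>add[of 0 0] by (simp only: add_0_right)
  then have s0: "\<sigma> 0 = 0" by (simp only: add_left_cancel)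
  have add1: "h (u + v) w = h u w + h v w" and scale1: "h (c *s u) w = c * h u w"
    and sym: "h w u = \<sigma> (h u w)" for u v w c
    using h(1) unfolding hermitian_form_def by blast+
  have add2: "h u (v + w) = h u v + h u w" for u v w
    using sym[of u "v + w"] sym[of u v] sym[of u w] by (simp add: add1 \<sigma>add)
  have scale2: "h u (c *s w) = \<sigma> c * h u w" for u c w
    using sym[of u "c *s w"] sym[of u w] by (simp add: scale1 \<sigma>mult)
  have h0: "h 0 w = 0" for w using scale1[of 0 0 w] by simp
  have symz: "h u w = 0 \<longleftrightarrow> h w u = 0" for u w using sym[of u w] sym[of w u] s0 by auto
  obtain s where s: "s * s = CARD('f)" "\<And>c. \<sigma> c = c \<Longrightarrow> card {y. y + \<sigma> y = c} = s"
    using field_involution_trace_fibres[OF \<sigma>] by blast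
  have q2: "CARD('f) \<ge> 2" by (rule card_field_ge2)
  have "polar h (\<lambda>v. h v v = 0) s TI D (real CARD('f))
    (real s * real CARD('f) ^ CARD('n) / real CARD('f) ^ (2 * D))"
  proof
    show "h (u + v) w = h u w + h v w" "h (c *s u) w = c * h u w" for u v w c by (fact add1, fact scale1)
    show "h u w = 0 \<longleftrightarrow> h w u = 0" for u w by (fact symz)
    show "h 0 0 = 0" by (fact h0)
    show "h (c *s u) (c *s u) = 0" if "h u u = 0" for c u using that by (simp add: scale1 scale2)
    show "h (u + v) (u + v) = 0" if "h u u = 0" "h v v = 0" "h u v = 0" for u v
      using that symz[of u v] by (simp add: add1 add2)
    show "u = 0" if "\<And>w. h u w = 0" for u using h(2) that by (auto simp: nondegenerate_def)
    show "card {a. h (p + a *s z) (p + a *s z) = 0} = s" if z: "h z z = 0" "h p z \<noteq> 0" for p z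
    proof -
      let ?b = "h z p"
      have b: "?b \<noteq> 0" using z(2) symz by blast
      have "\<sigma> (- h p p) = - h p p"
        using sym[of p p] \<sigma>add[of "h p p" "- h p p"] s0 by (simp add: eq_neg_iff_add_eq_0 add.commute)
      then have card_s: "card {y. y + \<sigma> y = - h p p} = s" by (rule s(2))
      have "h (p + a *s z) (p + a *s z) = h p p + (a * ?b + \<sigma> (a * ?b))" for a
        using sym[of p z] by (simp add: add1 add2 scale1 scale2 z \<sigma>mult)
      then have eq: "h (p + a *s z) (p + a *s z) = 0 \<longleftrightarrow> a * ?b + \<sigma> (a * ?b) = - h p p" for a
        by (simp add: eq_neg_iff_add_eq_0 add.commute)
      have "bij_betw (\<lambda>a. a * ?b) {a. h (p + a *s z) (p + a *s z) = 0} {y. y + \<sigma> y = - h p p}"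
        unfolding eq by (rule bij_betwI[where g = "\<lambda>y. y / ?b"]) (use b in auto)
      from bij_betw_same_card[OF this] show ?thesis using card_s by simp
    qed
    show "s > 0" using s(1) q2 by (cases s) auto
    show "TI = {U. vec.subspace U \<and> (\<forall>u\<in>U. h u u = 0) \<and> (\<forall>u\<in>U. \<forall>w\<in>U. h u w = 0)}"
      unfolding TI by blast
  qed (use D q2 in auto)
  with s(1) show ?thesis by (rule that)
qed

theorem theorem8p14:
  fixes TI :: "('f::{field,finite}^'n) set set" and D :: nat and e :: real
    and x :: "('f^'n) set" and C :: "('f^'n) set set"
  defines "q \<equiv> real CARD('f)"
    and "X \<equiv> dp_vertices TI"
    and "R \<equiv> dp_adj TI D"
    and "\<kappa> \<equiv> complex_of_real (real CARD('f) powr (- e / 2))"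
    and "\<kappa>' \<equiv> \<i> * complex_of_real (real CARD('f) powr (- real D / 2))"
  assumes "polar_space TI D e"
    and "D \<ge> 3"
    and "x \<in> C"
    and "is_maximal_clique R X C"
  shows "(\<forall>c :: nat \<Rightarrow> complex.
           orth_proj X {charvec (Gam R X x i) | i. i \<le> D}
              (\<lambda>v. \<Sum>j<2*D. c j * basis_vec R X x C j v)
         = (\<lambda>v. \<Sum>r<2*D. ((\<Sum>s<2*D. (T'mat q D r s + (if r = s then inverse \<kappa>' else 0)) * c s)
                            / (\<kappa>' + inverse \<kappa>')) * basis_vec R X x C r v))
       \<and> (\<forall>c :: nat \<Rightarrow> complex.
           orth_proj X {charvec {v \<in> X. set_dist R C v = i} | i. i \<le> D - 1}
              (\<lambda>v. \<Sum>j<2*D. c j * basis_vec R X x C j v)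
         = (\<lambda>v. \<Sum>r<2*D. ((\<Sum>s<2*D. (Tmat q e r s + (if r = s then inverse \<kappa> else 0)) * c s)
                            / (\<kappa> + inverse \<kappa>)) * basis_vec R X x C r v))"
proof -
  have q: "q \<ge> 2" using card_field_ge2[where 'f='f] by (simp add: q_def)
  have D1: "D \<ge> 1" using assms(7) by simp
  have Dmax: "D = Max (vec.dim ` TI)" using assms(6) by (simp add: polar_space_def)
  have powr: "q powr (real CARD('n) - 2 * real D) = q ^ CARD('n) / q ^ (2 * D)"
    using q powr_realpow[of q "2 * D"] by (simp add: powr_diff powr_realpow)
  \<comment> \<open>In each case \<open>M_eq\<close> forces M = s q^(n - 2D), with n the dimension
    of the space; what remains is to recognise this number as \<open>q powr e\<close>.\<close>
  have "\<exists>B iso s. polar B iso s TI D q (q powr e)"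
  proof -
    consider (alt) f where "alternating_form f" "nondegenerate f"
          "TI = {U. vec.subspace U \<and> (\<forall>u\<in>U. \<forall>w\<in>U. f u w = 0)}" "e = 1"
      | (herm) \<sigma> h where "hermitian_form \<sigma> h" "nondegenerate h"
          "TI = {U. vec.subspace U \<and> (\<forall>u\<in>U. \<forall>w\<in>U. h u w = 0)}" "e = real CARD('n) - 2 * real D + 1/2"
      | (quad) Q where "quadratic_form Q" "nondegenerate_quadratic Q"
          "TI = {U. vec.subspace U \<and> (\<forall>u\<in>U. Q u = 0)}" "e = real CARD('n) - 2 * real D"
      using assms(6) unfolding polar_space_def by (elim conjE disjE exE) (rule that; assumption)+
    then show ?thesis
    proof cases
      case alt
      note P = polar_alternating[OF alt(1-3) Dmax D1, folded q_def]
      interpret polar f "\<lambda>_. True" "CARD('f)" TI D q "q * q ^ CARD('n) / q ^ (2 * D)" by (fact P)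
      have xX: "x \<in> dp_vertices TI"
        using assms(8,9) by (auto simp: is_maximal_clique_def is_clique_def X_def)
      \<comment> \<open>The symplectic clause fixes e = 1 without mentioning the dimension, so n =
        2D has to be derived. As all vectors are isotropic, a vertex is its own perpendicular space,
        and comparing cardinalities gives q^(2D) = q^n.\<close>
      have "perp x = x"
        using X_perp_iso[OF xX TrueI] TI_D(3)[OF X_TI[OF xX]] by blast
      then have "q ^ D * q ^ D = q ^ CARD('n)"
        using card_perp_X_subset[OF xX X_subspace[OF xX]] dim_X[OF xX]
        by (simp add: card_subspace X_subspace[OF xX] q_def)
      then have "q * q ^ CARD('n) / q ^ (2 * D) = q powr e"
        using q alt(4) by (simp add: mult_2 power_add[symmetric])
      with P have "polar f (\<lambda>_. True) CARD('f) TI D q (q powr e)" by (simp only:)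
      then show ?thesis by (intro exI)
    next
      case herm
      obtain s where s: "s * s = CARD('f)" "polar h (\<lambda>v. h v v = 0) s TI D q
          (real s * q ^ CARD('n) / q ^ (2 * D))"
        using polar_hermitian[OF herm(1-3) Dmax D1, folded q_def] by blast
      have "real s * real s = q" using s(1) unfolding q_def by (metis of_nat_mult)
      \<comment> \<open>The factor s is the square root of q and accounts for the summand 1/2 in the
        Hermitian value of e.\<close>
      then have "q powr (1/2) = real s"
        using q by (simp add: powr_half_sqrt real_sqrt_unique power2_eq_square)
      then have "real s * q ^ CARD('n) / q ^ (2 * D) = q powr e"
        unfolding herm(4) powr_add powr by simp
      with s(2) have "polar h (\<lambda>v. h v v = 0) s TI D q (q powr e)" by (simp only:)
      then show ?thesis by (intro exI)
    next
      case quad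
      have "q ^ CARD('n) / q ^ (2 * D) = q powr e" unfolding quad(4) powr ..
      with polar_quadratic[OF quad(1-3) Dmax D1, folded q_def]
      have "polar (polar_form Q) (\<lambda>v. Q v = 0) 1 TI D q (q powr e)" by (simp only:)
      then show ?thesis by (intro exI)
    qed
  qed
  then obtain B iso s where "polar B iso s TI D q (q powr e)" by (elim exE)
  note proj = polar.projections_maximal_clique[OF this refl assms(8) assms(9)[unfolded R_def X_def], folded R_def X_def]
  show ?thesis
    unfolding \<kappa>_def \<kappa>'_def q_def[symmetric] by (intro conjI allI proj)
qed

end
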